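(* Let $n\ge 1$ and let $A,B,X\in\mathbb{M}_n$ be such that the block-matrix $\begin{bmatrix} A & X\\ X^* & B\end{bmatrix}$ belongs to $\mathbb{M}_{2n}^+$. Then for every symmetric norm $\|\cdot\|$ and every real $p>0$, $$\left\|\begin{bmatrix} A & X\\ X^* & B\end{bmatrix}^p\right\| \le 2^{|p-1|}\left\{\|(A+B)^p\| + \||X-X^*|^p\|\right\}.$$
   Context: $\mathbb{M}_n$ is the space of $n\times n$ complex matrices and $\mathbb{M}_n^+$ is its subset of positive semi-definite (Hermitian) matrices. For $Z\in\mathbb{M}_n$, $|Z|=(Z^*Z)^{1/2}$; powers of positive semi-definite matrices are taken via the functional calculus. A symmetric (unitarily invariant) norm on $\mathbb{M}_m$ is a norm with $\|UZ\|=\|ZU\|=\|Z\|$ for all $Z\in\mathbb{M}_m$ and all unitaries $U\in\mathbb{M}_m$. A symmetric norm on $\mathbb{M}_{2n}$ induces a symmetric norm on $\mathbb{M}_n$, denoted by the same symbol, by $\|Z\|:=\left\|\begin{bmatrix} Z&0\\0&0\end{bmatrix}\right\|$ for $Z\in\mathbb{M}_n$; norms of $n\times n$ matrices in the claim are understood in this sense. *)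

theory Defs
  imports Complex_Main "Jordan_Normal_Form.Schur_Decomposition"
begin

definition psd_mats :: "nat \<Rightarrow> complex mat set" where
  "psd_mats m = {A \<in> carrier_mat m m. mat_adjoint A = A \<and>
     (\<forall>v \<in> carrier_vec m. 0 \<le> Re ((A *\<^sub>v v) \<bullet>c v))}"

definition unitary_mats :: "nat \<Rightarrow> complex mat set" where
  "unitary_mats m = {U \<in> carrier_mat m m.
     mat_adjoint U * U = 1\<^sub>m m \<and> U * mat_adjoint U = 1\<^sub>m m}"

text \<open>Functional calculus of a Hermitian matrix. The result does not depend on the chosen
  unitary diagonalization, so the description is unique; the value is unspecified when
  the matrix is not Hermitian.\<close>

definition hermitian_fun :: "(real \<Rightarrow> real) \<Rightarrow> complex mat \<Rightarrow> complex mat" where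
  "hermitian_fun f A = (THE B. \<exists>U (d :: nat \<Rightarrow> real). U \<in> unitary_mats (dim_row A) \<and>
     A = U * mat_diag (dim_row A) (\<lambda>i. complex_of_real (d i)) * mat_adjoint U \<and>
     B = U * mat_diag (dim_row A) (\<lambda>i. complex_of_real (f (d i))) * mat_adjoint U)"

text \<open>Intended for positive semi-definite matrices and positive exponents;
  note that \<open>0 powr p = 0\<close>.\<close>

definition psd_power :: "complex mat \<Rightarrow> real \<Rightarrow> complex mat" where
  "psd_power A p = hermitian_fun (\<lambda>x. x powr p) A"

definition mat_abs :: "complex mat \<Rightarrow> complex mat" where
  "mat_abs Z = psd_power (mat_adjoint Z * Z) (1/2)"

text \<open>Only the values of the norm on \<open>carrier_mat m m\<close> are constrained.\<close>

definition symmetric_norm :: "nat \<Rightarrow> (complex mat \<Rightarrow> real) \<Rightarrow> bool" where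
  "symmetric_norm m N \<longleftrightarrow>
     (\<forall>Z \<in> carrier_mat m m. 0 \<le> N Z) \<and>
     (\<forall>Z \<in> carrier_mat m m. N Z = 0 \<longleftrightarrow> Z = 0\<^sub>m m m) \<and>
     (\<forall>Z \<in> carrier_mat m m. \<forall>c. N (c \<cdot>\<^sub>m Z) = cmod c * N Z) \<and>
     (\<forall>Y \<in> carrier_mat m m. \<forall>Z \<in> carrier_mat m m. N (Y + Z) \<le> N Y + N Z) \<and>
     (\<forall>Z \<in> carrier_mat m m. \<forall>U \<in> unitary_mats m. N (U * Z) = N Z \<and> N (Z * U) = N Z)"

definition induced_norm :: "nat \<Rightarrow> (complex mat \<Rightarrow> real) \<Rightarrow> complex mat \<Rightarrow> real" where
  "induced_norm n N Z = N (four_block_mat Z (0\<^sub>m n n) (0\<^sub>m n n) (0\<^sub>m n n))"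

end

theory Submission
  imports
    "HOL-Analysis.Equivalence_Lebesgue_Henstock_Integration"
    "HOL-Analysis.Convex"
    Defs
begin

text \<open>
  Write \<open>M\<close> for the block matrix and \<open>K = (X - X\<^sup>*) / (2 i)\<close>, so that \<open>\<bar>X - X\<^sup>*\<bar> = 2 \<bar>K\<bar>\<close>.
  Conjugation by the unitary with blocks \<open>1/\<surd>2\<close> on and \<open>i/\<surd>2\<close> off the diagonal turns \<open>M\<close> into
  a positive matrix with diagonal blocks \<open>(A + B)/2 + K\<close> and \<open>(A + B)/2 - K\<close>
  (\<open>block_rotation\<close>), both of which lie below \<open>(A + B + \<bar>2K\<bar>)/2\<close>. Everything then follows from two facts on powers of positive
  matrices, valid with the same constant \<open>c = max 1 (2 powr (p - 1))\<close>:

  \<^item> \<open>norm_power_block_le\<close>: the norm of \<open>T^p\<close> is at most \<open>c\<close> times the sum of the norms of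
    \<open>P^p\<close> and \<open>Q^p\<close>, where \<open>P\<close> and \<open>Q\<close> are the diagonal blocks of \<open>T \<ge> 0\<close>;
  \<^item> \<open>norm_power_mono\<close>: \<open>0 \<le> P \<le> T\<close> implies that \<open>P^p\<close> has at most the norm of \<open>T^p\<close>.

  The first fact contains the inequality \<open>\<parallel>(A + B)^p\<parallel> \<le> c (\<parallel>A^p\<parallel> + \<parallel>B^p\<parallel>)\<close>: with \<open>Z\<close> the block column of
  \<open>A^(1/2)\<close> over \<open>B^(1/2)\<close>, the matrix \<open>Z\<^sup>* Z\<close> is \<open>A + B\<close>, the matrix \<open>Z Z\<^sup>*\<close> has diagonal blocks \<open>A\<close> and
  \<open>B\<close>, and the two have the same nonzero eigenvalues. Applying the block estimate to \<open>M\<close>, monotonicity to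
  each block and subadditivity to \<open>(A + B + \<bar>2K\<bar>)/2\<close> gives the total constant \<open>2 c\<^sup>2 2 powr (-p)\<close>, which
  is \<open>2 powr \<bar>p - 1\<bar>\<close> both for \<open>p \<ge> 1\<close> and for \<open>p < 1\<close>.

  For the block estimate, let \<open>E\<close> and \<open>F\<close> be the two block projections. Since \<open>E + F = 1\<close>,
  \<open>T^q = T^(q/2) E T^(q/2) + T^(q/2) F T^(q/2)\<close>, and \<open>T^(q/2) E T^(q/2)\<close> is unitarily equivalent to
  \<open>E T^q E\<close> because \<open>G G\<^sup>*\<close> and \<open>G\<^sup>* G\<close> always are. If \<open>p < 1\<close>, take \<open>q = p\<close> and use
  Hansen's inequality \<open>E T^p E \<le> (E T E)^p\<close>. If \<open>p \<ge> 1\<close>, take \<open>q = 1\<close> and apply Jensen's inequality for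
  \<open>x powr p\<close> in an eigenbasis of \<open>T\<close>.

  Two elementary tools replace the theory of majorization and of operator monotone functions.
  A symmetric norm does not increase when a matrix is replaced by its diagonal in some orthonormal basis,
  so \<open>0 \<le> a i \<le> \<langle>Z u i, u i\<rangle>\<close> for an orthonormal basis \<open>u\<close> forces the matrix with eigenvalues \<open>a\<close> to have
  at most the norm of \<open>Z\<close> (\<open>norm_diag_conj_le\<close>). And \<open>t powr p\<close> is, for \<open>0 < p < 1\<close>, a positive
  superposition of the functions \<open>t / (t + s)\<close> with \<open>s > 0\<close>; the quadratic forms of \<open>T / (T + s)\<close> are minima of expressions
  that are monotone in \<open>T\<close> (\<open>quad_form_power_le\<close>).
\<close>

(* The dot and the dollar sign denote the scalar product and the entries of Matrix.vec below. *)
unbundle no inner_syntax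
no_notation vec_nth (infixl \<open>$\<close> 90)

section \<open>Adjoints, unitaries and quadratic forms\<close>

lemma square_mat_simps [simp]:
  fixes A B :: "'a :: semiring_1 mat"
  shows "A \<in> carrier_mat m m \<Longrightarrow> B \<in> carrier_mat m m \<Longrightarrow> A * B \<in> carrier_mat m m"
    and "A \<in> carrier_mat m m \<Longrightarrow> 1\<^sub>m m * A = A"
    and "A \<in> carrier_mat m m \<Longrightarrow> A * 1\<^sub>m m = A"
    and "A \<in> carrier_mat m m \<Longrightarrow> v \<in> carrier_vec m \<Longrightarrow> A *\<^sub>v v \<in> carrier_vec m"
  by auto

lemma mult_if_zero:
  fixes x y :: "'a :: mult_zero"
  shows "(if P then x else 0) * y = (if P then x * y else 0)"
    and "y * (if P then x else 0) = (if P then y * x else 0)"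
  by simp_all

lemma mat_adjoint_index [simp]:
  fixes A :: "complex mat"
  assumes "i < dim_col A" "j < dim_row A"
  shows "mat_adjoint A $$ (i, j) = cnj (A $$ (j, i))"
  using assms by (simp add: mat_adjoint_def mat_of_rows_def)

lemma dim_mat_adjoint [simp]:
  "dim_row (mat_adjoint A) = dim_col A" "dim_col (mat_adjoint A) = dim_row A"
  by (simp_all add: mat_adjoint_def)

lemma mat_adjoint_carrier [simp, intro]:
  "A \<in> carrier_mat n k \<Longrightarrow> mat_adjoint A \<in> carrier_mat k n"
  by (rule carrier_matI) auto

lemma mat_adjoint_adjoint [simp]: "mat_adjoint (mat_adjoint A) = (A :: complex mat)"
  by (rule eq_matI) auto

lemma mat_adjoint_mult:
  fixes A B :: "complex mat"
  assumes "A \<in> carrier_mat n k" "B \<in> carrier_mat k l"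
  shows "mat_adjoint (A * B) = mat_adjoint B * mat_adjoint A"
  by (rule eq_matI, insert assms, auto simp: scalar_prod_def mult.commute)

lemma mat_adjoint_add:
  fixes A B :: "complex mat"
  assumes "A \<in> carrier_mat n k" "B \<in> carrier_mat n k"
  shows "mat_adjoint (A + B) = mat_adjoint A + mat_adjoint B"
  by (rule eq_matI, insert assms, auto)

lemma mat_adjoint_diag: "mat_adjoint (mat_diag m f) = mat_diag m (\<lambda>i. cnj (f i))"
  by (rule eq_matI) (auto simp: mat_diag_def)

lemma mat_adjoint_one [simp]: "mat_adjoint (1\<^sub>m m) = (1\<^sub>m m :: complex mat)"
  by (rule eq_matI) auto

lemma mat_adjoint_zero [simp]: "mat_adjoint (0\<^sub>m n m) = (0\<^sub>m m n :: complex mat)"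
  by (rule eq_matI) auto

lemma mat_adjoint_four_block:
  fixes A :: "complex mat"
  assumes "A \<in> carrier_mat n k" "B \<in> carrier_mat n l" "C \<in> carrier_mat j k" "D \<in> carrier_mat j l"
  shows "mat_adjoint (four_block_mat A B C D)
    = four_block_mat (mat_adjoint A) (mat_adjoint C) (mat_adjoint B) (mat_adjoint D)"
  by (rule eq_matI, insert assms, auto)

lemma unitary_carrier: "U \<in> unitary_mats m \<Longrightarrow> U \<in> carrier_mat m m"
  by (simp add: unitary_mats_def)

lemma unitary_cancel_left: "U \<in> unitary_mats m \<Longrightarrow> mat_adjoint U * U = 1\<^sub>m m"
  by (simp add: unitary_mats_def)

lemma unitary_cancel_right: "U \<in> unitary_mats m \<Longrightarrow> U * mat_adjoint U = 1\<^sub>m m"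
  by (simp add: unitary_mats_def)

lemma unitary_adjoint: "U \<in> unitary_mats m \<Longrightarrow> mat_adjoint U \<in> unitary_mats m"
  by (auto simp: unitary_mats_def)

lemma unitary_one: "1\<^sub>m m \<in> unitary_mats m"
  by (auto simp: unitary_mats_def)

lemma unitary_mult:
  assumes "U \<in> unitary_mats m" "V \<in> unitary_mats m"
  shows "U * V \<in> unitary_mats m"
proof -
  note c = assms[THEN unitary_carrier]
  have "mat_adjoint (U * V) * (U * V) = mat_adjoint V * (mat_adjoint U * U) * V"
    using c by (simp add: mat_adjoint_mult[OF c] assoc_mult_mat[of _ m m _ m _ m])
  also have "\<dots> = 1\<^sub>m m"
    using c assms by (simp add: unitary_cancel_left)
  finally have 1: "mat_adjoint (U * V) * (U * V) = 1\<^sub>m m" .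
  have "(U * V) * mat_adjoint (U * V) = U * (V * mat_adjoint V) * mat_adjoint U"
    using c by (simp add: mat_adjoint_mult[OF c] assoc_mult_mat[of _ m m _ m _ m])
  also have "\<dots> = 1\<^sub>m m"
    using c assms by (simp add: unitary_cancel_right)
  finally show ?thesis using 1 c by (simp add: unitary_mats_def)
qed

lemma unitary_diag:
  assumes "\<And>i. i < m \<Longrightarrow> cmod (f i) = 1"
  shows "mat_diag m f \<in> unitary_mats m"
proof -
  have *: "f i * cnj (f i) = 1" if "i < m" for i
    using complex_norm_square[of "f i"] assms[OF that] by simp
  have "mat_diag m (\<lambda>i. f i * cnj (f i)) = 1\<^sub>m m"
    by (rule eq_matI) (simp_all add: mat_diag_def *)
  moreover have "mat_diag m (\<lambda>i. cnj (f i) * f i) = 1\<^sub>m m"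
    by (rule eq_matI) (simp_all add: mat_diag_def * mult.commute[of "cnj _"])
  ultimately show ?thesis by (simp add: unitary_mats_def mat_adjoint_diag)
qed

definition quad_form :: "complex mat \<Rightarrow> complex vec \<Rightarrow> real" where
  "quad_form A v = Re ((A *\<^sub>v v) \<bullet>c v)"

definition vec_norm_sq :: "complex vec \<Rightarrow> real" where
  "vec_norm_sq v = (\<Sum>i<dim_vec v. (cmod (v $ i))\<^sup>2)"

text \<open>With \<open>U\<close> unitary this is the general Hermitian matrix, written through its eigenvectors (the columns of
  \<open>U\<close>) and eigenvalues; functional calculus, products and quadratic forms then act on \<open>d\<close> alone.\<close>

definition diag_conj :: "complex mat \<Rightarrow> (nat \<Rightarrow> real) \<Rightarrow> complex mat" where
  "diag_conj U d = U * mat_diag (dim_row U) (\<lambda>i. complex_of_real (d i)) * mat_adjoint U"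

lemma cscalar_prod_self: "v \<bullet>c v = complex_of_real (vec_norm_sq v)"
  by (simp add: scalar_prod_def vec_norm_sq_def complex_norm_square atLeast0LessThan del: of_real_power)

lemma vec_norm_sq_nonneg: "0 \<le> vec_norm_sq v"
  by (simp add: vec_norm_sq_def sum_nonneg)

lemma cscalar_prod_adjoint:
  fixes A :: "complex mat"
  assumes A: "A \<in> carrier_mat n k" and v: "v \<in> carrier_vec k" and w: "w \<in> carrier_vec n"
  shows "(A *\<^sub>v v) \<bullet>c w = v \<bullet>c (mat_adjoint A *\<^sub>v w)"
proof -
  have "(A *\<^sub>v v) \<bullet>c w = (\<Sum>i<n. \<Sum>j<k. A $$ (i,j) * v $ j * cnj (w $ i))"
    using assms by (simp add: scalar_prod_def atLeast0LessThan sum_distrib_right)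
  also have "\<dots> = (\<Sum>j<k. \<Sum>i<n. A $$ (i,j) * v $ j * cnj (w $ i))"
    by (rule sum.swap)
  also have "\<dots> = v \<bullet>c (mat_adjoint A *\<^sub>v w)"
    using assms by (simp add: scalar_prod_def atLeast0LessThan sum_distrib_left mult_ac)
  finally show ?thesis .
qed

lemma vec_norm_sq_unitary:
  assumes U: "U \<in> unitary_mats m" and v: "v \<in> carrier_vec m"
  shows "vec_norm_sq (U *\<^sub>v v) = vec_norm_sq v"
proof -
  note c = unitary_carrier[OF U]
  have "(U *\<^sub>v v) \<bullet>c (U *\<^sub>v v) = v \<bullet>c (mat_adjoint U *\<^sub>v (U *\<^sub>v v))"
    using c v by (intro cscalar_prod_adjoint) auto
  also have "mat_adjoint U *\<^sub>v (U *\<^sub>v v) = v"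
    using c v unitary_cancel_left[OF U]
    by (simp flip: assoc_mult_mat_vec[of _ m m _ m])
  finally show ?thesis by (simp only: cscalar_prod_self of_real_eq_iff)
qed

lemma diag_conj_carrier [simp]: "U \<in> carrier_mat m m \<Longrightarrow> diag_conj U d \<in> carrier_mat m m"
  by (simp add: diag_conj_def)

lemma quad_form_congruence:
  assumes A: "A \<in> carrier_mat m m" and E: "E \<in> carrier_mat m m" and v: "v \<in> carrier_vec m"
  shows "quad_form (mat_adjoint E * A * E) v = quad_form A (E *\<^sub>v v)"
proof -
  have "(mat_adjoint E * A * E) *\<^sub>v v = mat_adjoint E *\<^sub>v (A *\<^sub>v (E *\<^sub>v v))"
    using assms by (simp add: assoc_mult_mat_vec[of _ m m _ m])
  then show ?thesis
    using assms cscalar_prod_adjoint[of "mat_adjoint E" m m "A *\<^sub>v (E *\<^sub>v v)" v]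
    by (simp add: quad_form_def)
qed

lemma quad_form_diag:
  assumes "v \<in> carrier_vec m"
  shows "quad_form (mat_diag m (\<lambda>i. complex_of_real (d i))) v = (\<Sum>i<m. d i * (cmod (v $ i))\<^sup>2)"
proof -
  have "mat_diag m (\<lambda>i. complex_of_real (d i)) *\<^sub>v v = vec m (\<lambda>i. complex_of_real (d i) * v $ i)"
    using assms by (intro eq_vecI) (auto simp: mat_diag_def scalar_prod_def mult_if_zero)
  moreover have "Re (complex_of_real c * z * cnj z) = c * (cmod z)\<^sup>2" for c z
    by (simp add: cmod_power2[unfolded power2_eq_square] power2_eq_square algebra_simps)
  ultimately show ?thesis
    using assms by (simp add: quad_form_def scalar_prod_def atLeast0LessThan)
qed

lemma quad_form_diag_conj:
  assumes U: "U \<in> carrier_mat m m" and v: "v \<in> carrier_vec m"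
  shows "quad_form (diag_conj U d) v = (\<Sum>i<m. d i * (cmod ((mat_adjoint U *\<^sub>v v) $ i))\<^sup>2)"
proof -
  have "quad_form (diag_conj U d) v
    = quad_form (mat_diag m (\<lambda>i. complex_of_real (d i))) (mat_adjoint U *\<^sub>v v)"
    using U v quad_form_congruence[of "mat_diag m (\<lambda>i. complex_of_real (d i))" m "mat_adjoint U" v]
    by (simp add: diag_conj_def)
  also have "\<dots> = (\<Sum>i<m. d i * (cmod ((mat_adjoint U *\<^sub>v v) $ i))\<^sup>2)"
    using U v by (intro quad_form_diag) auto
  finally show ?thesis .
qed

lemma quad_form_add:
  assumes "A \<in> carrier_mat m m" "B \<in> carrier_mat m m" "v \<in> carrier_vec m"
  shows "quad_form (A + B) v = quad_form A v + quad_form B v"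
  using assms by (simp add: quad_form_def add_mult_distrib_mat_vec[of _ m m]
     add_scalar_prod_distrib[of _ m])

lemma quad_form_smult:
  assumes "A \<in> carrier_mat m m" "v \<in> carrier_vec m"
  shows "quad_form (complex_of_real c \<cdot>\<^sub>m A) v = c * quad_form A v"
proof -
  have "(complex_of_real c \<cdot>\<^sub>m A) *\<^sub>v v = complex_of_real c \<cdot>\<^sub>v (A *\<^sub>v v)"
    using assms by (intro eq_vecI) (auto simp: scalar_prod_def sum_distrib_left mult.assoc)
  then show ?thesis using assms by (simp add: quad_form_def)
qed

lemma psd_matsI:
  assumes "A \<in> carrier_mat m m" "mat_adjoint A = A"
    "\<And>v. v \<in> carrier_vec m \<Longrightarrow> 0 \<le> quad_form A v"
  shows "A \<in> psd_mats m"
  using assms by (auto simp: psd_mats_def quad_form_def)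

lemma psd_carrier: "A \<in> psd_mats m \<Longrightarrow> A \<in> carrier_mat m m"
  and psd_hermitian: "A \<in> psd_mats m \<Longrightarrow> mat_adjoint A = A"
  and psd_quad_form: "A \<in> psd_mats m \<Longrightarrow> v \<in> carrier_vec m \<Longrightarrow> 0 \<le> quad_form A v"
  by (auto simp: psd_mats_def quad_form_def)

lemma diag_conj_adjoint:
  assumes U: "U \<in> carrier_mat m m"
  shows "mat_adjoint (diag_conj U d) = diag_conj U d"
  using U by (simp add: diag_conj_def mat_adjoint_mult[of _ m m _ m] mat_adjoint_diag
     assoc_mult_mat[of _ m m _ m _ m])

lemma diag_conj_psd:
  assumes U: "U \<in> carrier_mat m m" and d: "\<And>i. i < m \<Longrightarrow> 0 \<le> d i"
  shows "diag_conj U d \<in> psd_mats m"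
  using assms
  by (intro psd_matsI diag_conj_carrier diag_conj_adjoint)
     (auto simp: quad_form_diag_conj intro!: sum_nonneg)

lemma diag_conj_mult:
  assumes U: "U \<in> unitary_mats m"
  shows "diag_conj U d * diag_conj U e = diag_conj U (\<lambda>i. d i * e i)"
proof -
  note c = unitary_carrier[OF U]
  let ?D = "\<lambda>d. mat_diag m (\<lambda>i. complex_of_real (d i))"
  have "diag_conj U d * diag_conj U e
      = U * ?D d * (mat_adjoint U * U) * ?D e * mat_adjoint U"
    using c by (simp add: diag_conj_def assoc_mult_mat[of _ m m _ m _ m])
  also have "\<dots> = U * (?D d * ?D e) * mat_adjoint U"
    using c unfolding unitary_cancel_left[OF U] by (simp add: assoc_mult_mat[of _ m m _ m _ m])
  finally show ?thesis using c by (simp add: diag_conj_def)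
qed

lemma diag_conj_cong:
  assumes U: "U \<in> carrier_mat m m" and "\<And>i. i < m \<Longrightarrow> d i = e i"
  shows "diag_conj U d = diag_conj U e"
proof -
  have "mat_diag m (\<lambda>i. complex_of_real (d i)) = mat_diag m (\<lambda>i. complex_of_real (e i))"
    by (rule eq_matI) (auto simp: mat_diag_def assms)
  then show ?thesis using U by (simp add: diag_conj_def)
qed

lemma diag_conj_conj:
  assumes V: "V \<in> carrier_mat m m" and U: "U \<in> carrier_mat m m"
  shows "V * diag_conj U d * mat_adjoint V = diag_conj (V * U) d"
  using assms by (simp add: diag_conj_def mat_adjoint_mult[of _ m m _ m] assoc_mult_mat[of _ m m _ m _ m])

lemma quad_form_col:
  assumes Z: "Z \<in> carrier_mat m m" and U: "U \<in> carrier_mat m m" and i: "i < m"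
  shows "quad_form Z (col U i) = Re ((mat_adjoint U * Z * U) $$ (i, i))"
proof -
  let ?B = "mat_adjoint U * Z * U"
  have B: "?B \<in> carrier_mat m m" using Z U by auto
  have "U *\<^sub>v unit_vec m i = col U i"
    using U i by (intro eq_vecI) (auto simp: scalar_prod_def mult_if_zero)
  then have "quad_form Z (col U i) = quad_form ?B (unit_vec m i)"
    using quad_form_congruence[OF Z U, of "unit_vec m i"] i by simp
  also have "\<dots> = Re (?B $$ (i, i))"
  proof -
    have "conjugate (unit_vec m i) = (unit_vec m i :: complex vec)"
      by (rule eq_vecI) (auto simp: unit_vec_def)
    moreover have "(M *\<^sub>v unit_vec m i) $ i = M $$ (i, i)"
      if "M \<in> carrier_mat m m" for M :: "complex mat"
      using that i by (auto simp: scalar_prod_right_unit[of _ m])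
    note this[OF B]
    ultimately have "(?B *\<^sub>v unit_vec m i) \<bullet>c unit_vec m i = ?B $$ (i,i)"
      using B i by (simp add: scalar_prod_right_unit[of _ m] del: index_mult_mat_vec)
    then show ?thesis by (simp only: quad_form_def)
  qed
  finally show ?thesis .
qed

lemma vec_norm_sq_col:
  assumes U: "U \<in> unitary_mats m" and i: "i < m"
  shows "vec_norm_sq (col U i) = 1"
proof -
  have "col U i = U *\<^sub>v unit_vec m i"
    using unitary_carrier[OF U] i by (intro eq_vecI) (auto simp: scalar_prod_def mult_if_zero)
  then have "vec_norm_sq (col U i) = vec_norm_sq (unit_vec m i :: complex vec)"
    using vec_norm_sq_unitary[OF U, of "unit_vec m i"] by simp
  also have "\<dots> = 1" using i by (simp add: vec_norm_sq_def unit_vec_def if_distrib[of "\<lambda>x. (cmod x)\<^sup>2"] cong: if_cong)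
  finally show ?thesis .
qed

lemma quad_form_diag_conj_col:
  assumes U: "U \<in> unitary_mats m" and i: "i < m"
  shows "quad_form (diag_conj U d) (col U i) = d i"
proof -
  note c = unitary_carrier[OF U]
  have "mat_adjoint U * diag_conj U d * U = diag_conj (mat_adjoint U * U) d"
    using diag_conj_conj[of "mat_adjoint U" m U d] c by simp
  also have "\<dots> = mat_diag m (\<lambda>i. complex_of_real (d i))"
    unfolding unitary_cancel_left[OF U] by (simp add: diag_conj_def)
  finally show ?thesis using quad_form_col[of "diag_conj U d" m U i] c i by (simp add: mat_diag_def)
qed

section \<open>Functional calculus\<close>

text \<open>Two unitary diagonalizations of the same matrix are intertwined by \<open>W = V\<^sup>* U\<close>, whose entry \<open>(i, j)\<close> vanishes
  unless the eigenvalues \<open>e i\<close> and \<open>d j\<close> agree. Hence \<open>W\<close> also intertwines the images under \<open>f\<close>,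
  and the description in the definition is unique.\<close>

lemma hermitian_fun_diag_conj:
  assumes U: "U \<in> unitary_mats m"
  shows "hermitian_fun f (diag_conj U d) = diag_conj U (\<lambda>i. f (d i))"
proof -
  note cU = unitary_carrier[OF U]
  let ?D = "\<lambda>d. mat_diag m (\<lambda>i. complex_of_real (d i))"
  have dimr: "dim_row (diag_conj U d) = m" "dim_row U = m"
    using cU carrier_matD(1)[OF diag_conj_carrier[OF cU, of d]] by auto
  have uniq: "B = diag_conj U (\<lambda>i. f (d i))"
    if V: "V \<in> unitary_mats m" and eq: "diag_conj U d = V * ?D e * mat_adjoint V"
      and B: "B = V * ?D (\<lambda>i. f (e i)) * mat_adjoint V" for B V e
  proof -
    note cV = unitary_carrier[OF V]
    define W where "W = mat_adjoint V * U"
    have cW: "W \<in> carrier_mat m m" using cU cV by (simp add: W_def)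
    have "W * ?D d = mat_adjoint V * (U * ?D d * (mat_adjoint U * U))"
      unfolding unitary_cancel_left[OF U] using cU cV
      by (simp add: W_def assoc_mult_mat[of _ m m _ m _ m])
    also have "\<dots> = mat_adjoint V * diag_conj U d * U"
      using cU cV by (simp add: diag_conj_def assoc_mult_mat[of _ m m _ m _ m])
    also have "\<dots> = (mat_adjoint V * V) * ?D e * W"
      unfolding eq using cU cV by (simp add: W_def assoc_mult_mat[of _ m m _ m _ m])
    finally have WD: "W * ?D d = ?D e * W"
      unfolding unitary_cancel_left[OF V] using cW by simp
    have comm: "W $$ (i, j) * complex_of_real (f (d j)) = complex_of_real (f (e i)) * W $$ (i, j)"
      if ij: "i < m" "j < m" for i j
    proof -
      have "W $$ (i, j) * complex_of_real (d j) = complex_of_real (e i) * W $$ (i, j)"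
        using arg_cong[OF WD, of "\<lambda>M. M $$ (i, j)"] ij
        unfolding mat_diag_mult_left[OF cW] mat_diag_mult_right[OF cW] by simp
      then have "W $$ (i, j) = 0 \<or> d j = e i" by (simp add: mult.commute[of "W $$ (i, j)"])
      then show ?thesis by (auto simp: mult.commute[of "W $$ (i, j)"])
    qed
    have WfD: "W * ?D (\<lambda>i. f (d i)) = ?D (\<lambda>i. f (e i)) * W"
      unfolding mat_diag_mult_left[OF cW] mat_diag_mult_right[OF cW]
      by (intro eq_matI) (simp_all add: comm)
    have "diag_conj U (\<lambda>i. f (d i)) = (V * mat_adjoint V) * U * ?D (\<lambda>i. f (d i)) * mat_adjoint U"
      unfolding unitary_cancel_right[OF V] using cU by (simp add: diag_conj_def)
    also have "\<dots> = V * (W * ?D (\<lambda>i. f (d i))) * mat_adjoint U"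
      using cU cV by (simp add: W_def assoc_mult_mat[of _ m m _ m _ m])
    also have "\<dots> = V * ?D (\<lambda>i. f (e i)) * mat_adjoint V * (U * mat_adjoint U)"
      unfolding WfD using cU cV by (simp add: W_def assoc_mult_mat[of _ m m _ m _ m])
    also have "\<dots> = B"
      unfolding unitary_cancel_right[OF U] B using cV by (simp add: assoc_mult_mat[of _ m m _ m _ m])
    finally show ?thesis by simp
  qed
  show ?thesis
    unfolding hermitian_fun_def dimr
  proof (rule the_equality)
    show "\<exists>V e. V \<in> unitary_mats m \<and> diag_conj U d = V * ?D e * mat_adjoint V \<and>
        diag_conj U (\<lambda>i. f (d i)) = V * ?D (\<lambda>i. f (e i)) * mat_adjoint V"
      using U by (intro exI[of _ U] exI[of _ d]) (simp add: diag_conj_def dimr)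
  qed (use uniq in blast)
qed

lemma psd_power_diag_conj:
  "U \<in> unitary_mats m \<Longrightarrow> psd_power (diag_conj U d) p = diag_conj U (\<lambda>i. d i powr p)"
  by (simp add: psd_power_def hermitian_fun_diag_conj)

section \<open>The spectral theorem with a prescribed list of eigenvalues\<close>

lemma unitary_matsI:
  assumes U: "U \<in> carrier_mat m m" and "mat_adjoint U * U = 1\<^sub>m m"
  shows "U \<in> unitary_mats m"
  using assms mat_mult_left_right_inverse[of "mat_adjoint U" m U] by (simp add: unitary_mats_def)

lemma adjoint_mult_index:
  fixes W :: "complex mat"
  assumes "W \<in> carrier_mat n m" "i < m" "j < m"
  shows "(mat_adjoint W * W) $$ (i, j) = col W j \<bullet>c col W i"
  using assms by (simp add: scalar_prod_def mult.commute)

text \<open>Gram-Schmidt applied to a basis that starts with \<open>v\<close>, followed by normalization of the columns.\<close>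

lemma unitary_first_column:
  fixes v :: "complex vec"
  assumes v: "v \<in> carrier_vec n" and v0: "v \<noteq> 0\<^sub>v n"
  shows "\<exists>W c. W \<in> unitary_mats n \<and> c \<noteq> 0 \<and> col W 0 = c \<cdot>\<^sub>v v"
proof -
  interpret cof_vec_space n "TYPE(complex)" .
  define b where "b = basis_completion v"
  define ws where "ws = gram_schmidt n b"
  define u where "u = (\<lambda>w :: complex vec. complex_of_real (1 / sqrt (vec_norm_sq w)) \<cdot>\<^sub>v w)"
  define W where "W = mat_of_cols n (map u ws)"
  from basis_completion[OF v v0, folded b_def]
  have dist_b: "distinct b" and indep: "\<not> lin_dep (set b)" and b: "set b \<subseteq> carrier_vec n"
    and hdb: "hd b = v" and len_b: "length b = n" by auto
  have n: "n \<noteq> 0" using v v0 by (cases "n = 0") auto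
  from hdb len_b n obtain vs where bv: "b = v # vs" by (cases b) auto
  from gram_schmidt_result[OF b dist_b indep refl, folded ws_def]
  have ws: "set ws \<subseteq> carrier_vec n" "corthogonal ws" "length ws = n"
    by (auto simp: len_b)
  have ws_hd: "ws ! 0 = v"
    using gram_schmidt_hd[OF v, of vs, folded bv] ws(3) n by (metis hd_conv_nth list.size(3) ws_def)
  have carr: "ws ! i \<in> carrier_vec n" if "i < n" for i
    using ws that by auto
  have uc: "u w \<in> carrier_vec n" if "w \<in> carrier_vec n" for w using that by (simp add: u_def)
  have W: "W \<in> carrier_mat n n" using ws by (simp add: W_def carrier_matI)
  have colW: "col W i = u (ws ! i)" if "i < n" for i
    using that ws uc[OF carr[OF that]] by (simp add: W_def)
  have pos: "vec_norm_sq (ws ! i) > 0" if "i < n" for i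
  proof -
    have "(ws ! i) \<bullet>c (ws ! i) \<noteq> 0"
      using corthogonalD[OF ws(2), of i i] that ws(3) by simp
    then have "vec_norm_sq (ws ! i) \<noteq> 0" by (simp add: cscalar_prod_self)
    then show ?thesis using vec_norm_sq_nonneg[of "ws ! i"] by simp
  qed
  have "col W j \<bullet>c col W i = (if i = j then 1 else 0)" if ij: "i < n" "j < n" for i j
  proof -
    have cj: "conjugate (complex_of_real r) = complex_of_real r" for r
      by (simp add: conjugate_complex_def)
    have "col W j \<bullet>c col W i = complex_of_real (1 / sqrt (vec_norm_sq (ws ! j)))
        * (complex_of_real (1 / sqrt (vec_norm_sq (ws ! i))) * (ws ! j \<bullet>c ws ! i))"
      using carr[OF ij(1)] carr[OF ij(2)]
      by (simp add: colW ij u_def conjugate_smult_vec cj smult_scalar_prod_distrib[of _ n]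
           scalar_prod_smult_distrib[of _ n] del: of_real_divide)
    also have "\<dots> = (if i = j then 1 else 0)"
    proof (cases "i = j")
      case True
      have "1 / sqrt (vec_norm_sq (ws ! j)) * (1 / sqrt (vec_norm_sq (ws ! j)) * vec_norm_sq (ws ! j)) = 1"
        using pos[OF ij(2)] by (simp add: real_div_sqrt field_simps)
      with True show ?thesis
        unfolding cscalar_prod_self by (metis cscalar_prod_self of_real_1 of_real_mult)
    next
      case False
      then show ?thesis using corthogonalD[OF ws(2), of j i] ij ws(3) by simp
    qed
    finally show ?thesis .
  qed
  then have "mat_adjoint W * W = 1\<^sub>m n"
    using W by (intro eq_matI) (auto simp: adjoint_mult_index simp del: index_mult_mat(1))
  then have "W \<in> unitary_mats n" using W by (rule unitary_matsI[rotated])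
  moreover have "col W 0 = complex_of_real (1 / sqrt (vec_norm_sq v)) \<cdot>\<^sub>v v"
    using colW[of 0] n by (simp add: u_def ws_hd)
  moreover have "complex_of_real (1 / sqrt (vec_norm_sq v)) \<noteq> 0"
    using pos[of 0] n ws_hd by simp
  ultimately show ?thesis by blast
qed

lemma unitary_four_block:
  assumes U: "U \<in> unitary_mats n" and V: "V \<in> unitary_mats m"
  shows "four_block_mat U (0\<^sub>m n m) (0\<^sub>m m n) V \<in> unitary_mats (n + m)"
proof -
  note c = unitary_carrier[OF U] unitary_carrier[OF V]
  let ?F = "four_block_mat U (0\<^sub>m n m) (0\<^sub>m m n) V"
  have "mat_adjoint ?F * ?F = four_block_mat (1\<^sub>m n) (0\<^sub>m n m) (0\<^sub>m m n) (1\<^sub>m m)"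
    using c by (simp add: mat_adjoint_four_block[of _ n n _ m _ m] mult_four_block_mat[of _ n n _ m _ m _ _ n _ m]
      unitary_cancel_left[OF U] unitary_cancel_left[OF V])
  also have "\<dots> = 1\<^sub>m (n + m)" by (rule eq_matI) auto
  finally show ?thesis using c by (intro unitary_matsI) auto
qed

lemma mat_diag_four_block:
  "four_block_mat (mat_diag n f) (0\<^sub>m n m) (0\<^sub>m m n) (mat_diag m g)
    = mat_diag (n + m) (\<lambda>i. if i < n then f i else g (i - n))"
  by (rule eq_matI) (auto simp: mat_diag_def)

text \<open>The order of the eigenvalues is prescribed in advance by a list, because below two different matrices with equal
  characteristic polynomials have to be diagonalized to the same diagonal matrix.
  Each step splits off one eigenvector: in a basis that starts with it, the Hermitian matrix is
  block diagonal.\<close>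

lemma spectral_theorem_complex:
  assumes "A \<in> carrier_mat n n" "mat_adjoint A = A"
    and "char_poly A = (\<Prod>e\<leftarrow>es. [:- e, 1:])"
  shows "\<exists>U \<in> unitary_mats n. A = U * mat_diag n (\<lambda>i. es ! i) * mat_adjoint U"
  using assms
proof (induction es arbitrary: A n)
  case Nil
  then have "n = 0" using degree_monic_char_poly[of A n] by simp
  with Nil show ?case
    by (intro bexI[of _ "1\<^sub>m 0"]) (auto intro!: eq_matI simp: unitary_one mat_diag_def)
next
  case (Cons e es)
  note A = Cons.prems(1)
  define p where "p = (\<Prod>e\<leftarrow>es. [:- e, 1:])"
  have cp: "char_poly A = [:- e, 1:] * p" using Cons.prems(3) by (simp add: p_def)
  have "monic p" unfolding p_def by (rule monic_prod_list) auto
  then have "degree (char_poly A) = Suc (degree p)"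
    unfolding cp by (subst degree_mult_eq) auto
  then obtain k where n: "n = Suc k" using degree_monic_char_poly[OF A] by auto
  have n0: "0 < n" using n by simp
  have "eigenvalue A e" unfolding eigenvalue_root_char_poly[OF A] cp by simp
  then obtain v where v: "v \<in> carrier_vec n" "v \<noteq> 0\<^sub>v n" "A *\<^sub>v v = e \<cdot>\<^sub>v v"
    using A by (auto simp: eigenvalue_def eigenvector_def)
  obtain W c where W: "W \<in> unitary_mats n" and c: "col W 0 = c \<cdot>\<^sub>v v"
    using unitary_first_column[OF v(1,2)] by blast
  note cW = unitary_carrier[OF W]
  define A' where "A' = mat_adjoint W * A * W"
  have A': "A' \<in> carrier_mat n n" using A cW by (simp add: A'_def)
  have herm: "mat_adjoint A' = A'"
    using A cW Cons.prems(2)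
    by (simp add: A'_def mat_adjoint_mult[of _ n n _ n] assoc_mult_mat[of _ n n _ n _ n])
  have A_eq: "A = W * A' * mat_adjoint W"
  proof -
    have "W * A' * mat_adjoint W = (W * mat_adjoint W) * A * (W * mat_adjoint W)"
      using A cW by (simp add: A'_def assoc_mult_mat[of _ n n _ n _ n])
    then show ?thesis using A by (simp add: unitary_cancel_right[OF W])
  qed
  have col: "A' $$ (i, 0) = (if i = 0 then e else 0)" if "i < n" for i
  proof -
    have "col A' 0 = mat_adjoint W *\<^sub>v (A *\<^sub>v col W 0)"
      using A cW n0 by (simp add: A'_def col_mult2[of _ n n _ n] assoc_mult_mat_vec[of _ n n _ n])
    also have "A *\<^sub>v col W 0 = e \<cdot>\<^sub>v col W 0"
      using A v by (simp add: c mult_mat_vec[of _ n n] smult_smult_assoc mult.commute)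
    also have "mat_adjoint W *\<^sub>v (e \<cdot>\<^sub>v col W 0) = e \<cdot>\<^sub>v col (mat_adjoint W * W) 0"
      using cW n0 by (simp add: mult_mat_vec[of _ n n] col_mult2[of _ n n _ n])
    also have "\<dots> = e \<cdot>\<^sub>v unit_vec n 0"
      unfolding unitary_cancel_left[OF W] using n by simp
    finally have "col A' 0 $ i = (e \<cdot>\<^sub>v unit_vec n 0) $ i" by simp
    then show ?thesis using A' that n by simp
  qed
  have row: "A' $$ (0, i) = (if i = 0 then cnj e else 0)" if "i < n" for i
    using arg_cong[OF herm, of "\<lambda>M. M $$ (0, i)"] A' that n0 col[of i] by (cases "i = 0") auto
  define A3 where "A3 = Matrix.mat k k (\<lambda>(i, j). A' $$ (Suc i, Suc j))"
  let ?e = "mat_diag 1 (\<lambda>i. e)"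
  have A3: "A3 \<in> carrier_mat k k" by (simp add: A3_def)
  have block: "A' = four_block_mat ?e (0\<^sub>m 1 k) (0\<^sub>m k 1) A3"
  proof (rule eq_matI)
    fix i j assume "i < dim_row (four_block_mat ?e (0\<^sub>m 1 k) (0\<^sub>m k 1) A3)"
      and "j < dim_col (four_block_mat ?e (0\<^sub>m 1 k) (0\<^sub>m k 1) A3)"
    then have "i < n" "j < n" using n by (auto simp: A3_def mat_diag_def)
    then show "A' $$ (i, j) = four_block_mat ?e (0\<^sub>m 1 k) (0\<^sub>m k 1) A3 $$ (i, j)"
      using n col[of i] row[of j] by (cases i; cases j) (auto simp: A3_def mat_diag_def)
  qed (use A' n in \<open>auto simp: A3_def mat_diag_def\<close>)
  have herm3: "mat_adjoint A3 = A3"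
  proof (rule eq_matI)
    fix i j assume "i < dim_row A3" "j < dim_col A3"
    then show "mat_adjoint A3 $$ (i, j) = A3 $$ (i, j)"
      using arg_cong[OF herm, of "\<lambda>M. M $$ (Suc i, Suc j)"] A' n by (simp add: A3_def)
  qed (simp_all add: A3_def)
  have "char_poly A' = char_poly A"
    by (rule char_poly_similar, unfold similar_mat_def, rule exI[of _ "mat_adjoint W"], rule exI[of _ W],
      rule similar_mat_witI[of _ _ n])
      (use A A' cW W in \<open>simp_all add: A'_def unitary_cancel_left unitary_cancel_right\<close>)
  moreover have "char_poly A' = char_poly ?e * char_poly A3"
    unfolding block using A3 by (intro char_poly_four_block_zeros_col) auto
  moreover have "char_poly ?e = [:- e, 1:]"
    by (simp add: char_poly_defs det_def sign_def mat_diag_def)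
  ultimately have "[:- e, 1:] * char_poly A3 = [:- e, 1:] * p" using cp by simp
  then have "char_poly A3 = p" by (metis mult_cancel_left pCons_eq_0_iff zero_neq_one)
  then obtain U where U: "U \<in> unitary_mats k" "A3 = U * mat_diag k (\<lambda>i. es ! i) * mat_adjoint U"
    using Cons.IH[OF A3 herm3] by (auto simp: p_def)
  note cU = unitary_carrier[OF U(1)]
  define V where "V = four_block_mat (1\<^sub>m 1) (0\<^sub>m 1 k) (0\<^sub>m k 1) U"
  let ?D = "mat_diag n (\<lambda>i. (e # es) ! i)"
  have V: "V \<in> unitary_mats n"
    using unitary_four_block[OF unitary_one U(1), of 1] n by (simp add: V_def)
  note cV = unitary_carrier[OF V]
  have "?D = four_block_mat ?e (0\<^sub>m 1 k) (0\<^sub>m k 1) (mat_diag k (\<lambda>i. es ! i))"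
    unfolding mat_diag_four_block n by (rule eq_matI) (auto simp: mat_diag_def nth_Cons')
  then have "V * ?D * mat_adjoint V = A'"
    unfolding block U(2) using cU
    by (simp add: V_def mat_adjoint_four_block[of _ 1 1 _ k _ k]
      mult_four_block_mat[of _ 1 1 _ k _ k _ _ 1 _ k] left_mult_zero_mat[of _ 1 1]
      left_mult_zero_mat[of _ k k] right_mult_zero_mat[of _ k k] right_mult_zero_mat[of _ 1 1] del: One_nat_def)
  then have A'_eq: "A' = V * ?D * mat_adjoint V" by simp
  have "A = (W * V) * ?D * mat_adjoint (W * V)"
    unfolding A_eq A'_eq using cW cV
    by (simp add: mat_adjoint_mult[of _ n n _ n] assoc_mult_mat[of _ n n _ n _ n])
  then show ?case using unitary_mult[OF W V] by blast
qed

lemma spectral_theorem_list: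
  assumes A: "A \<in> carrier_mat n n" and herm: "mat_adjoint A = A"
    and cp: "char_poly A = (\<Prod>e\<leftarrow>es. [:- e, 1:])"
  shows "\<exists>U \<in> unitary_mats n. A = diag_conj U (\<lambda>i. Re (es ! i))"
proof -
  obtain U where U: "U \<in> unitary_mats n" "A = U * mat_diag n (\<lambda>i. es ! i) * mat_adjoint U"
    using spectral_theorem_complex[OF assms] by blast
  note cU = unitary_carrier[OF U(1)]
  define D where "D = mat_diag n (\<lambda>i. es ! i)"
  have cD: "D \<in> carrier_mat n n" by (simp add: D_def)
  have "D = (mat_adjoint U * U) * D * (mat_adjoint U * U)"
    unfolding unitary_cancel_left[OF U(1)] using cD by simp
  also have "\<dots> = mat_adjoint U * A * U"
    using cU cD U(2) by (simp add: D_def assoc_mult_mat[of _ n n _ n _ n])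
  finally have DA: "D = mat_adjoint U * A * U" .
  have D: "mat_adjoint D = D"
    unfolding DA using cU A herm
    by (simp add: mat_adjoint_mult[of _ n n _ n] assoc_mult_mat[of _ n n _ n _ n])
  have "cnj (es ! i) = es ! i" if "i < n" for i
    using arg_cong[OF D, of "\<lambda>M. M $$ (i, i)"] that by (simp add: D_def mat_adjoint_diag mat_diag_def)
  then have "complex_of_real (Re (es ! i)) = es ! i" if "i < n" for i
    using that by (simp add: complex_eq_iff)
  then have "D = mat_diag n (\<lambda>i. complex_of_real (Re (es ! i)))"
    by (intro eq_matI) (auto simp: D_def mat_diag_def)
  then show ?thesis using U cU by (intro bexI[of _ U]) (simp_all add: diag_conj_def D_def)
qed

lemma psd_spectral:
  assumes A: "A \<in> psd_mats n"
  obtains U d where "U \<in> unitary_mats n" "A = diag_conj U d" "\<And>i. i < n \<Longrightarrow> 0 \<le> d i"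
proof -
  obtain es where "char_poly A = (\<Prod>e\<leftarrow>es. [:- e, 1:])"
    using char_poly_factorized[OF psd_carrier[OF A]] by blast
  then obtain U where U: "U \<in> unitary_mats n" "A = diag_conj U (\<lambda>i. Re (es ! i))"
    using spectral_theorem_list[OF psd_carrier[OF A] psd_hermitian[OF A]] by blast
  have "0 \<le> Re (es ! i)" if "i < n" for i
  proof -
    have "col U i \<in> carrier_vec n" using unitary_carrier[OF U(1)] by auto
    from psd_quad_form[OF A this] show ?thesis
      using quad_form_diag_conj_col[OF U(1) that, of "\<lambda>i. Re (es ! i)"] U(2) by simp
  qed
  with U show ?thesis using that by blast
qed

text \<open>With \<open>l\<close> the embedding of constants into polynomials, \<open>det (x - A B)\<close> is the determinant of the block matrix with
  rows \<open>(x, l A)\<close> and \<open>(l B, 1)\<close>; exchanging its two block rows and block columns gives the block matrix whose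
  determinant is \<open>det (x - B A)\<close>.\<close>

lemma char_poly_mult_commute:
  fixes A B :: "complex mat"
  assumes A: "A \<in> carrier_mat n n" and B: "B \<in> carrier_mat n n"
  shows "char_poly (A * B) = char_poly (B * A)"
proof -
  let ?l = "map_mat (\<lambda>x :: complex. [:x:])"
  let ?X = "[:0, 1:] \<cdot>\<^sub>m (1\<^sub>m n :: complex poly mat)"
  let ?one = "1\<^sub>m n :: complex poly mat" and ?zero = "0\<^sub>m n n :: complex poly mat"
  have cl: "?l M \<in> carrier_mat n n" if "M \<in> carrier_mat n n" for M :: "complex mat" using that by simp
  have cX: "?X \<in> carrier_mat n n" by (rule smult_carrier_mat) simp
  have cp: "char_poly (P * Q) = det (?X * ?one - ?l P * ?l Q)"
    if P: "P \<in> carrier_mat n n" and Q: "Q \<in> carrier_mat n n" for P Q :: "complex mat"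
  proof -
    have const_sum: "[:\<Sum>x\<in>S. f x:] = (\<Sum>x\<in>S. [:f x:])"
      if "finite S" for f :: "nat \<Rightarrow> complex" and S
      using that
    proof (induction S)
      case (insert x S)
      then show ?case by (simp flip: insert.IH)
    qed simp
    have "?l P * ?l Q = ?l (P * Q)"
      by (rule eq_matI, insert P Q, auto simp: scalar_prod_def const_sum mult.commute)
    then show ?thesis unfolding char_poly_defs
      by (intro arg_cong[of _ _ det] eq_matI, insert P Q, auto)
  qed
  let ?J = "four_block_mat ?zero ?one ?one ?zero"
  have JJ: "?J * ?J = 1\<^sub>m (n + n)"
    by (subst mult_four_block_mat[of _ n n _ n _ n _ _ n _ n]) (auto intro: eq_matI)
  have cJ: "?J \<in> carrier_mat (n + n) (n + n)" by auto
  let ?F = "four_block_mat ?X (?l A) (?l B) ?one"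
  have cF: "?F \<in> carrier_mat (n + n) (n + n)" using A B by auto
  have "?J * ?F * ?J = four_block_mat ?one (?l B) (?l A) ?X"
    using A B by (simp add: mult_four_block_mat[of _ n n _ n _ n _ _ n _ n])
  moreover have "det (?J * ?F * ?J) = det ?F * det (?J * ?J)"
    using cJ cF by (simp add: det_mult[of _ "n + n"] mult.commute mult.left_commute)
  ultimately have swap: "det (four_block_mat ?one (?l B) (?l A) ?X) = det ?F"
    unfolding JJ by simp
  have "char_poly (A * B) = det ?F"
    unfolding cp[OF A B] using cl[OF A] cl[OF B]
    by (intro det_four_block_mat[symmetric]) auto
  also have "\<dots> = det (?one * ?X - ?l B * ?l A)"
    unfolding swap[symmetric]
    by (rule det_four_block_mat[OF one_carrier_mat cl[OF B] cl[OF A] cX])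
       (use cl[OF A] in \<open>simp add: mult_smult_distrib[of _ n n _ n] mult_smult_assoc_mat[of _ n n _ n]\<close>)
  also have "?one * ?X = ?X * ?one" by simp
  finally show ?thesis unfolding cp[OF B A] .
qed

text \<open>This is the part of the singular value decomposition that norms can see: \<open>Z Z\<^sup>*\<close> and \<open>Z\<^sup>* Z\<close> are unitarily equivalent.\<close>

lemma mult_adjoint_diag_conj:
  fixes Z :: "complex mat"
  assumes Z: "Z \<in> carrier_mat m m"
  obtains U V d where "U \<in> unitary_mats m" "V \<in> unitary_mats m"
    "Z * mat_adjoint Z = diag_conj U d" "mat_adjoint Z * Z = diag_conj V d"
proof -
  have cZ: "mat_adjoint Z \<in> carrier_mat m m" using Z by simp
  obtain es where es: "char_poly (Z * mat_adjoint Z) = (\<Prod>e\<leftarrow>es. [:- e, 1:])"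
    using char_poly_factorized[of "Z * mat_adjoint Z" m] Z by auto
  then have es': "char_poly (mat_adjoint Z * Z) = (\<Prod>e\<leftarrow>es. [:- e, 1:])"
    by (simp add: char_poly_mult_commute[OF Z cZ])
  have "\<exists>U \<in> unitary_mats m. Z * mat_adjoint Z = diag_conj U (\<lambda>i. Re (es ! i))"
    using Z es by (intro spectral_theorem_list) (simp_all add: mat_adjoint_mult[of _ m m _ m])
  moreover have "\<exists>V \<in> unitary_mats m. mat_adjoint Z * Z = diag_conj V (\<lambda>i. Re (es ! i))"
    using Z es' by (intro spectral_theorem_list) (simp_all add: mat_adjoint_mult[of _ m m _ m])
  ultimately show ?thesis using that by blast
qed

section \<open>Real powers: convexity and resolvent integrals\<close>

text \<open>The endpoint \<open>0\<close> matters here, since positive semidefinite matrices may have the eigenvalue \<open>0\<close>.\<close>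

lemma convex_on_powr:
  fixes p :: real
  assumes p: "p \<ge> 1"
  shows "convex_on {0..} (\<lambda>x. x powr p)"
proof (rule convex_onI)
  fix t x y :: real assume t: "0 < t" "t < 1" and xy: "x \<in> {0..}" "y \<in> {0..}"
  have scaled: "(u * z) powr p \<le> u * z powr p" if "0 < u" "u < 1" "z \<ge> 0" for u z :: real
  proof -
    have "u powr p \<le> u powr 1" using that p by (intro powr_mono') auto
    then show ?thesis using that by (simp add: powr_mult mult_right_mono)
  qed
  consider "x = 0" | "y = 0" | "x > 0" "y > 0" using xy by force
  then show "((1 - t) *\<^sub>R x + t *\<^sub>R y) powr p \<le> (1 - t) * x powr p + t * y powr p"
  proof cases
    case 3
    then show ?thesis using convex_onD[OF powr_convex[OF p], of t x y] t by simp
  qed (use scaled t xy p in auto)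
qed simp

lemma powr_add_le:
  fixes a b p :: real
  assumes "p \<ge> 1" "a \<ge> 0" "b \<ge> 0"
  shows "(a + b) powr p \<le> 2 powr (p - 1) * (a powr p + b powr p)"
proof -
  have "((a + b) / 2) powr p \<le> (a powr p + b powr p) / 2"
    using convex_onD[OF convex_on_powr[OF assms(1)], of "1/2" a b] assms by (simp add: field_simps)
  moreover have "((a + b) / 2) powr p = (a + b) powr p / 2 powr p"
    using assms by (simp add: powr_divide)
  ultimately show ?thesis by (simp add: powr_diff field_simps)
qed

text \<open>The substitution \<open>s = t u\<close> extracts the factor \<open>t powr p\<close>. The integral for \<open>t = 1\<close> converges at \<open>0\<close>
  because \<open>p > 0\<close> and at infinity because \<open>p < 1\<close>.\<close>

lemma powr_kernel_nn_integral:
  fixes p :: real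
  assumes p: "0 < p" "p < 1"
  defines "h \<equiv> \<lambda>t s. indicator {0<..} s * (t / (t + s) * s powr (p - 1)) :: real"
  shows "\<exists>c>0. \<forall>t\<ge>0. (\<integral>\<^sup>+ s. ennreal (h t s) \<partial>lborel) = ennreal (c * t powr p)"
proof -
  have h_meas [measurable]: "h t \<in> borel_measurable borel" for t
    unfolding h_def by measurable
  define C where "C = (\<integral>\<^sup>+ s. ennreal (h 1 s) \<partial>lborel)"
  have scale: "(\<integral>\<^sup>+ s. ennreal (h t s) \<partial>lborel) = ennreal (t powr p) * C" if t: "t > 0" for t
  proof -
    have hs: "h t (t * u) = t powr (p - 1) * h 1 u" for u
    proof (cases "u > 0")
      case True
      have "t / (t + t * u) = (t * 1) / (t * (1 + u))" by (simp add: distrib_left)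
      also have "\<dots> = 1 / (1 + u)" using t by (simp only: mult_divide_mult_cancel_left)
      finally have "t / (t + t * u) = 1 / (1 + u)" .
      with True t show ?thesis by (simp add: h_def powr_mult del: times_divide_eq_left)
    next
      case False
      with t show ?thesis by (simp add: h_def zero_less_mult_iff)
    qed
    have "(\<integral>\<^sup>+ s. ennreal (h t s) \<partial>lborel) = ennreal t * (\<integral>\<^sup>+ u. ennreal (h t (t * u)) \<partial>lborel)"
      using nn_integral_real_affine[of "\<lambda>s. ennreal (h t s)" t 0] t by simp
    also have "(\<integral>\<^sup>+ u. ennreal (h t (t * u)) \<partial>lborel)
        = (\<integral>\<^sup>+ u. ennreal (t powr (p - 1)) * ennreal (h 1 u) \<partial>lborel)"
      by (simp add: hs ennreal_mult')
    also have "\<dots> = ennreal (t powr (p - 1)) * C"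
      unfolding C_def by (rule nn_integral_cmult) measurable
    finally show ?thesis
      using t by (simp add: mult.assoc[symmetric] powr_diff flip: ennreal_mult)
  qed
  \<comment> \<open>The integrand is at most \<open>s powr (p - 1)\<close> on \<open>[0, 1]\<close> and at most \<open>s powr (p - 2)\<close> on \<open>[1, \<infinity>)\<close>.\<close>
  have "C < \<infinity>"
  proof -
    obtain I where I: "((\<lambda>s. s powr (p - 1)) has_integral I) {0..1::real}"
      using has_integral_powr_from_0[of "p - 1" 1] p by auto
    obtain J where J: "((\<lambda>s. s powr (p - 2)) has_integral J) {1::real..}"
      using has_integral_powr_to_inf[of "p - 2" 1] p by auto
    have "C \<le> (\<integral>\<^sup>+ s. ennreal (indicator {0..1} s * s powr (p - 1))
        + ennreal (indicator {1..} s * s powr (p - 2)) \<partial>lborel)"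
      unfolding C_def
    proof (rule nn_integral_mono)
      fix s :: real
      have "h 1 s \<le> indicator {0..1} s * s powr (p - 1) + indicator {1..} s * s powr (p - 2)"
      proof (cases "s > 0")
        case True
        have "1 / (1 + s) * s powr (p - 1) \<le> 1 * s powr (p - 1)"
          using True by (intro mult_right_mono) auto
        moreover have "1 / (1 + s) * s powr (p - 1) \<le> 1 / s * s powr (p - 1)"
          using True by (intro mult_right_mono divide_left_mono) auto
        moreover have "1 / s * s powr (p - 1) = s powr (p - 2)"
          using True by (simp add: powr_diff power2_eq_square)
        ultimately show ?thesis using True by (auto simp: h_def indicator_def)
      qed (simp add: h_def)
      then show "ennreal (h 1 s) \<le> ennreal (indicator {0..1} s * s powr (p - 1))
        + ennreal (indicator {1..} s * s powr (p - 2))"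
        by (simp add: ennreal_leI flip: ennreal_plus)
    qed
    also have "\<dots> = (\<integral>\<^sup>+ s. ennreal (indicator {0..1} s * s powr (p - 1)) \<partial>lborel)
        + (\<integral>\<^sup>+ s. ennreal (indicator {1..} s * s powr (p - 2)) \<partial>lborel)"
      by (rule nn_integral_add) measurable
    also have "\<dots> = ennreal I + ennreal J"
      using nn_integral_has_integral_lebesgue[OF _ I] nn_integral_has_integral_lebesgue[OF _ J] by simp
    finally show ?thesis by (rule le_less_trans) simp
  qed
  then obtain c where c: "C = ennreal c" "c \<ge> 0" by (cases C) auto
  have "0 < C"
  proof -
    have "(\<integral>\<^sup>+ s. ennreal (2 powr (p - 1) / 3) * indicator {1..2::real} s \<partial>lborel) \<le> C"
      unfolding C_def
    proof (rule nn_integral_mono)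
      fix s :: real
      have "2 powr (p - 1) / 3 \<le> h 1 s" if "s \<in> {1..2}"
      proof -
        have "2 powr (p - 1) \<le> s powr (p - 1)"
          using that p by (intro powr_mono2') auto
        then have "2 powr (p - 1) / 3 \<le> s powr (p - 1) / (1 + s)"
          using that by (intro frac_le) auto
        then show ?thesis using that by (simp add: h_def)
      qed
      then show "ennreal (2 powr (p - 1) / 3) * indicator {1..2} s \<le> ennreal (h 1 s)"
        by (auto simp: indicator_def intro: ennreal_leI)
    qed
    moreover have "(\<integral>\<^sup>+ s. ennreal (2 powr (p - 1) / 3) * indicator {1..2::real} s \<partial>lborel)
        = ennreal (2 powr (p - 1) / 3)"
      by (subst nn_integral_cmult_indicator) auto
    ultimately show ?thesis by (auto intro: less_le_trans[rotated])
  qed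
  with c have "c > 0" by auto
  moreover have "(\<integral>\<^sup>+ s. ennreal (h t s) \<partial>lborel) = ennreal (c * t powr p)" if "t \<ge> 0" for t
  proof (cases "t = 0")
    case True
    then show ?thesis by (simp add: h_def)
  next
    case False
    then show ?thesis using scale[of t] that c by (simp add: ennreal_mult mult.commute)
  qed
  ultimately show ?thesis by blast
qed

text \<open>The hypothesis is integrated against the positive weight \<open>s powr (p - 1)\<close>. This is the scalar form of the principle
  that an inequality between resolvents passes to fractional powers.\<close>

lemma powr_sum_le_of_resolvent_sum_le:
  fixes d x :: "'a \<Rightarrow> real" and e y :: "'b \<Rightarrow> real"
  assumes p: "0 < p" "p < 1" and fin: "finite I" "finite J"
    and d: "\<And>i. i \<in> I \<Longrightarrow> 0 \<le> d i" "\<And>i. i \<in> I \<Longrightarrow> 0 \<le> x i"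
    and e: "\<And>j. j \<in> J \<Longrightarrow> 0 \<le> e j" "\<And>j. j \<in> J \<Longrightarrow> 0 \<le> y j"
    and le: "\<And>s. s > 0 \<Longrightarrow> (\<Sum>i\<in>I. d i / (d i + s) * x i) \<le> (\<Sum>j\<in>J. e j / (e j + s) * y j)"
  shows "(\<Sum>i\<in>I. d i powr p * x i) \<le> (\<Sum>j\<in>J. e j powr p * y j)"
proof -
  define h where "h = (\<lambda>t s. indicator {0<..} s * (t / (t + s) * s powr (p - 1)) :: real)"
  obtain c where c: "c > 0"
    and int: "\<And>t. t \<ge> 0 \<Longrightarrow> (\<integral>\<^sup>+ s. ennreal (h t s) \<partial>lborel) = ennreal (c * t powr p)"
    using powr_kernel_nn_integral[OF p] unfolding h_def by blast
  have h_meas [measurable]: "h t \<in> borel_measurable borel" for t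
    unfolding h_def by measurable
  have h0: "h t s \<ge> 0" if "t \<ge> 0" for t s using that by (auto simp: h_def indicator_def)
  have sum: "(\<integral>\<^sup>+ s. ennreal (\<Sum>k\<in>K. z k * h (f k) s) \<partial>lborel) = ennreal (c * (\<Sum>k\<in>K. f k powr p * z k))"
    if K: "finite K" and f: "\<And>k. k \<in> K \<Longrightarrow> 0 \<le> f k" and z: "\<And>k. k \<in> K \<Longrightarrow> 0 \<le> z k"
    for K :: "'k set" and f z
  proof -
    have "(\<integral>\<^sup>+ s. ennreal (\<Sum>k\<in>K. z k * h (f k) s) \<partial>lborel)
        = (\<integral>\<^sup>+ s. (\<Sum>k\<in>K. ennreal (z k) * ennreal (h (f k) s)) \<partial>lborel)"
      using f z h0 by (simp add: ennreal_mult flip: sum_ennreal cong: sum.cong)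
    also have "\<dots> = (\<Sum>k\<in>K. \<integral>\<^sup>+ s. ennreal (z k) * ennreal (h (f k) s) \<partial>lborel)"
      by (rule nn_integral_sum) measurable
    also have "\<dots> = (\<Sum>k\<in>K. ennreal (z k) * ennreal (c * f k powr p))"
      using f by (intro sum.cong refl, subst nn_integral_cmult) (auto simp: int)
    also have "\<dots> = (\<Sum>k\<in>K. ennreal (c * (f k powr p * z k)))"
      using z c by (intro sum.cong) (auto simp: mult_ac simp flip: ennreal_mult)
    also have "\<dots> = ennreal (\<Sum>k\<in>K. c * (f k powr p * z k))"
      using z c by (intro sum_ennreal) auto
    finally show ?thesis by (simp add: sum_distrib_left)
  qed
  have eq: "(\<Sum>k\<in>K. z k * h (f k) s)
      = indicator {0<..} s * s powr (p - 1) * (\<Sum>k\<in>K. f k / (f k + s) * z k)"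
    for K :: "'k set" and f z s
    by (simp add: h_def sum_distrib_left mult_ac)
  have "(\<Sum>i\<in>I. x i * h (d i) s) \<le> (\<Sum>j\<in>J. y j * h (e j) s)" for s
    unfolding eq by (cases "s > 0") (simp_all add: mult_left_mono le del: times_divide_eq_left)
  then have "(\<integral>\<^sup>+ s. ennreal (\<Sum>i\<in>I. x i * h (d i) s) \<partial>lborel)
      \<le> (\<integral>\<^sup>+ s. ennreal (\<Sum>j\<in>J. y j * h (e j) s) \<partial>lborel)"
    by (intro nn_integral_mono ennreal_leI)
  then have "ennreal (c * (\<Sum>i\<in>I. d i powr p * x i)) \<le> ennreal (c * (\<Sum>j\<in>J. e j powr p * y j))"
    using sum[OF fin(1) d] sum[OF fin(2) e] by simp
  moreover have "0 \<le> (\<Sum>j\<in>J. e j powr p * y j)"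
    using e by (intro sum_nonneg) auto
  ultimately show ?thesis using c by (simp add: ennreal_le_iff)
qed

section \<open>Symmetric norms\<close>

lemma mat_diag_add:
  "mat_diag m f + mat_diag m g = mat_diag m (\<lambda>i. f i + g i :: complex)"
  by (rule eq_matI) (auto simp: mat_diag_def)

lemma mat_diag_smult:
  "c \<cdot>\<^sub>m mat_diag m f = mat_diag m (\<lambda>i. c * f i :: complex)"
  by (rule eq_matI) (auto simp: mat_diag_def)

lemma mat_diag_cong:
  "(\<And>i. i < m \<Longrightarrow> f i = g i) \<Longrightarrow> mat_diag m f = mat_diag m g"
  by (rule eq_matI) (auto simp: mat_diag_def)

context
  fixes m :: nat and N :: "complex mat \<Rightarrow> real"
  assumes N: "symmetric_norm m N"
begin

lemma norm_smult:
  assumes "Z \<in> carrier_mat m m" "c \<ge> 0"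
  shows "N (complex_of_real c \<cdot>\<^sub>m Z) = c * N Z"
  using N assms by (simp add: symmetric_norm_def)

lemma norm_add: "Y \<in> carrier_mat m m \<Longrightarrow> Z \<in> carrier_mat m m \<Longrightarrow> N (Y + Z) \<le> N Y + N Z"
  and norm_unitary_left: "Z \<in> carrier_mat m m \<Longrightarrow> U \<in> unitary_mats m \<Longrightarrow> N (U * Z) = N Z"
  and norm_unitary_right: "Z \<in> carrier_mat m m \<Longrightarrow> U \<in> unitary_mats m \<Longrightarrow> N (Z * U) = N Z"
  using N by (simp_all add: symmetric_norm_def)

lemma norm_conj:
  assumes "Z \<in> carrier_mat m m" "U \<in> unitary_mats m"
  shows "N (U * Z * mat_adjoint U) = N Z"
  using assms unitary_carrier[OF assms(2)]
  by (simp add: norm_unitary_left norm_unitary_right unitary_adjoint)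

lemma norm_convex_combination:
  assumes "Y \<in> carrier_mat m m" "Z \<in> carrier_mat m m" "N Z \<le> N Y" "0 \<le> t" "t \<le> 1"
  shows "N (complex_of_real t \<cdot>\<^sub>m Y + complex_of_real (1 - t) \<cdot>\<^sub>m Z) \<le> N Y"
proof -
  have "N (complex_of_real t \<cdot>\<^sub>m Y + complex_of_real (1 - t) \<cdot>\<^sub>m Z)
      \<le> N (complex_of_real t \<cdot>\<^sub>m Y) + N (complex_of_real (1 - t) \<cdot>\<^sub>m Z)"
    using assms by (intro norm_add) auto
  also have "\<dots> = t * N Y + (1 - t) * N Z"
    using norm_smult[of Y t] norm_smult[of Z "1 - t"] assms by simp
  also have "\<dots> \<le> t * N Y + (1 - t) * N Y"
    using assms by (intro add_mono mult_left_mono) auto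
  finally show ?thesis by (simp add: algebra_simps)
qed

text \<open>Averaging \<open>Z\<close> with \<open>D Z D\<close>, where \<open>D\<close> flips the sign of one basis vector, removes the off-diagonal part of one row and
  column and does not increase the norm. After all \<open>m\<close> rows only the diagonal is left.\<close>

lemma norm_diag_le:
  assumes Z: "Z \<in> carrier_mat m m"
  shows "N (mat_diag m (\<lambda>i. Z $$ (i, i))) \<le> N Z"
proof -
  define P where "P = (\<lambda>k. Matrix.mat m m (\<lambda>(i, j). if i = j \<or> (k \<le> i \<and> k \<le> j) then Z $$ (i, j) else 0))"
  have P: "P k \<in> carrier_mat m m" for k by (simp add: P_def)
  have "N (P k) \<le> N Z" for k
  proof (induction k)
    case 0
    have "P 0 = Z" using Z by (intro eq_matI) (auto simp: P_def)
    then show ?case by simp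
  next
    case (Suc k)
    define D where "D = mat_diag m (\<lambda>i. if i = k then -1 else 1 :: complex)"
    have D: "D \<in> unitary_mats m" unfolding D_def by (rule unitary_diag) auto
    have cD: "D \<in> carrier_mat m m" using unitary_carrier[OF D] .
    have "P (Suc k) = complex_of_real (1/2) \<cdot>\<^sub>m P k + complex_of_real (1 - 1/2) \<cdot>\<^sub>m (D * P k * D)"
    proof -
      have DP: "D * P k * D = Matrix.mat m m (\<lambda>(i, j). (if i = k then -1 else 1) * P k $$ (i, j) * (if j = k then -1 else 1))"
        unfolding D_def mat_diag_mult_left[OF P]
        by (subst mat_diag_mult_right[of _ m]) (auto intro!: eq_matI)
      show ?thesis unfolding DP
        by (intro eq_matI) (auto simp: P_def)
    qed
    moreover have "N (D * P k * D) = N (P k)"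
      using P[of k] D cD by (simp add: norm_unitary_left norm_unitary_right)
    ultimately have "N (P (Suc k)) \<le> N (P k)"
      using norm_convex_combination[OF P[of k], of "D * P k * D" "1/2"] P[of k] cD by simp
    then show ?case using Suc by simp
  qed
  from this[of m] have "N (P m) \<le> N Z" .
  moreover have "P m = mat_diag m (\<lambda>i. Z $$ (i, i))"
    by (rule eq_matI) (auto simp: P_def mat_diag_def)
  ultimately show ?thesis by simp
qed

text \<open>Lowering one entry from \<open>b k\<close> to \<open>a k\<close> is a convex combination of the identity and the sign flip of that entry.\<close>

lemma norm_diag_mono:
  fixes a b :: "nat \<Rightarrow> real"
  assumes ab: "\<And>i. i < m \<Longrightarrow> 0 \<le> a i" "\<And>i. i < m \<Longrightarrow> a i \<le> b i"
  shows "N (mat_diag m (\<lambda>i. complex_of_real (a i))) \<le> N (mat_diag m (\<lambda>i. complex_of_real (b i)))"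
proof -
  define P where "P = (\<lambda>k. mat_diag m (\<lambda>i. complex_of_real (if i < k then a i else b i)))"
  have P: "P k \<in> carrier_mat m m" for k by (simp add: P_def)
  have "N (P k) \<le> N (P 0)" if "k \<le> m" for k
    using that
  proof (induction k)
    case (Suc k)
    have k: "k < m" using Suc.prems by simp
    \<comment> \<open>Chosen so that \<open>t b k - (1 - t) b k = a k\<close>; if \<open>b k = 0\<close> then also \<open>a k = 0\<close>.\<close>
    define t where "t = (if b k = 0 then 1 else (1 + a k / b k) / 2)"
    have t: "0 \<le> t" "t \<le> 1" "a k = (t - (1 - t)) * b k"
      using ab[OF k] by (auto simp: t_def field_simps)
    define D where "D = mat_diag m (\<lambda>i. if i = k then -1 else 1 :: complex)"
    have D: "D \<in> unitary_mats m" unfolding D_def by (rule unitary_diag) auto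
    have "P (Suc k) = complex_of_real t \<cdot>\<^sub>m P k + complex_of_real (1 - t) \<cdot>\<^sub>m (D * P k)"
      unfolding P_def D_def mat_diag_diag mat_diag_smult mat_diag_add
    proof (rule mat_diag_cong)
      fix i assume "i < m"
      show "complex_of_real (if i < Suc k then a i else b i) =
         complex_of_real t * complex_of_real (if i < k then a i else b i) +
         complex_of_real (1 - t) * ((if i = k then - 1 else 1) * complex_of_real (if i < k then a i else b i))"
        using t(3) by (cases "i = k") (auto simp: algebra_simps simp flip: of_real_mult of_real_add)
    qed
    moreover have "N (D * P k) = N (P k)"
      using P[of k] D by (simp add: norm_unitary_left)
    ultimately have "N (P (Suc k)) \<le> N (P k)"
      using norm_convex_combination[OF P[of k], of "D * P k" t] P[of k] unitary_carrier[OF D] t by simp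
    then show ?case using Suc by simp
  qed simp
  from this[of m] have "N (P m) \<le> N (P 0)" by simp
  moreover have "P m = mat_diag m (\<lambda>i. complex_of_real (a i))"
    unfolding P_def by (rule mat_diag_cong) simp
  ultimately show ?thesis by (simp add: P_def)
qed

lemma norm_diag_conj:
  assumes "U \<in> unitary_mats m"
  shows "N (diag_conj U d) = N (mat_diag m (\<lambda>i. complex_of_real (d i)))"
  using norm_conj[of "mat_diag m (\<lambda>i. complex_of_real (d i))" U] assms unitary_carrier[OF assms]
  by (simp add: diag_conj_def)

text \<open>This is the comparison principle behind all norm estimates below. In the basis \<open>U\<close> the diagonal of \<open>Z\<close> dominates \<open>a\<close>,
  and passing from \<open>Z\<close> to its diagonal does not increase the norm.\<close>

lemma norm_diag_conj_le:
  assumes U: "U \<in> unitary_mats m" and Z: "Z \<in> carrier_mat m m"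
    and a: "\<And>i. i < m \<Longrightarrow> 0 \<le> a i" "\<And>i. i < m \<Longrightarrow> a i \<le> quad_form Z (col U i)"
  shows "N (diag_conj U a) \<le> N Z"
proof -
  note cU = unitary_carrier[OF U]
  define B where "B = mat_adjoint U * Z * U"
  have B: "B \<in> carrier_mat m m" using cU Z by (simp add: B_def)
  \<comment> \<open>The phases turn the diagonal entries into their absolute values, which dominate the real parts.\<close>
  define \<phi> where "\<phi> = (\<lambda>i. if B $$ (i, i) = 0 then 1 else cnj (B $$ (i, i)) / complex_of_real (cmod (B $$ (i, i))))"
  have \<phi>: "mat_diag m \<phi> \<in> unitary_mats m"
    by (rule unitary_diag) (auto simp: \<phi>_def norm_divide)
  have phase: "\<phi> i * B $$ (i, i) = complex_of_real (cmod (B $$ (i, i)))" for i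
    by (simp add: \<phi>_def complex_norm_square[symmetric] power2_eq_square mult.commute)
  have "N (diag_conj U a) = N (mat_diag m (\<lambda>i. complex_of_real (a i)))"
    by (rule norm_diag_conj[OF U])
  also have "\<dots> \<le> N (mat_diag m (\<lambda>i. complex_of_real (cmod (B $$ (i, i)))))"
  proof (rule norm_diag_mono[OF a(1)])
    fix i assume "i < m"
    then have "a i \<le> Re (B $$ (i, i))"
      using a(2)[of i] quad_form_col[OF Z cU, of i] by (simp add: B_def)
    also have "\<dots> \<le> cmod (B $$ (i, i))" by (rule complex_Re_le_cmod)
    finally show "a i \<le> cmod (B $$ (i, i))" .
  qed
  also have "\<dots> = N (mat_diag m \<phi> * mat_diag m (\<lambda>i. B $$ (i, i)))"
    by (simp add: phase)
  also have "\<dots> = N (mat_diag m (\<lambda>i. B $$ (i, i)))"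
    by (rule norm_unitary_left[OF mat_diag_dim \<phi>])
  also have "\<dots> \<le> N B" by (rule norm_diag_le[OF B])
  also have "N B = N Z"
    using norm_conj[of Z "mat_adjoint U"] Z U by (simp add: B_def unitary_adjoint)
  finally show ?thesis .
qed

lemma norm_mono:
  assumes Y: "Y \<in> psd_mats m" and Z: "Z \<in> carrier_mat m m"
    and le: "\<And>v. v \<in> carrier_vec m \<Longrightarrow> quad_form Y v \<le> quad_form Z v"
  shows "N Y \<le> N Z"
proof -
  obtain U d where U: "U \<in> unitary_mats m" "Y = diag_conj U d" "\<And>i. i < m \<Longrightarrow> 0 \<le> d i"
    using psd_spectral[OF Y] by blast
  have "col U i \<in> carrier_vec m" for i using unitary_carrier[OF U(1)] by auto
  then have "d i \<le> quad_form Z (col U i)" if "i < m" for i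
    using le[of "col U i"] quad_form_diag_conj_col[OF U(1) that, of d] U(2) by simp
  then show ?thesis unfolding U(2) using U Z by (intro norm_diag_conj_le) auto
qed

lemma norm_power_mult_adjoint:
  assumes "Z \<in> carrier_mat m m"
  shows "N (psd_power (Z * mat_adjoint Z) p) = N (psd_power (mat_adjoint Z * Z) p)"
    and "N (Z * mat_adjoint Z) = N (mat_adjoint Z * Z)"
proof -
  obtain U V d where U: "U \<in> unitary_mats m" and V: "V \<in> unitary_mats m"
    and "Z * mat_adjoint Z = diag_conj U d" "mat_adjoint Z * Z = diag_conj V d"
    using mult_adjoint_diag_conj[OF assms] by blast
  then show "N (psd_power (Z * mat_adjoint Z) p) = N (psd_power (mat_adjoint Z * Z) p)"
    and "N (Z * mat_adjoint Z) = N (mat_adjoint Z * Z)"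
    by (simp_all add: psd_power_diag_conj norm_diag_conj)
qed

end

section \<open>Powers of positive semidefinite matrices\<close>

lemma psd_power_psd:
  assumes "A \<in> psd_mats m"
  shows "psd_power A p \<in> psd_mats m"
proof -
  obtain U d where U: "U \<in> unitary_mats m" "A = diag_conj U d"
    using psd_spectral[OF assms] by blast
  then show ?thesis
    by (auto simp: psd_power_diag_conj intro!: diag_conj_psd unitary_carrier)
qed

lemma psd_power_carrier: "A \<in> psd_mats m \<Longrightarrow> psd_power A p \<in> carrier_mat m m"
  by (rule psd_carrier[OF psd_power_psd])

lemma psd_power_mult:
  assumes "A \<in> psd_mats m"
  shows "psd_power A p * psd_power A q = psd_power A (p + q)"
proof -
  obtain U d where U: "U \<in> unitary_mats m" "A = diag_conj U d"
    using psd_spectral[OF assms] by blast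
  then show ?thesis
    by (simp add: psd_power_diag_conj diag_conj_mult powr_add)
qed

lemma psd_power_1:
  assumes "A \<in> psd_mats m"
  shows "psd_power A 1 = A"
proof -
  obtain U d where U: "U \<in> unitary_mats m" "A = diag_conj U d" "\<And>i. i < m \<Longrightarrow> 0 \<le> d i"
    using psd_spectral[OF assms] by blast
  then show ?thesis
    using diag_conj_cong[OF unitary_carrier[OF U(1)], of "\<lambda>i. d i powr 1" d]
    by (simp add: psd_power_diag_conj)
qed

lemma psd_power_unitary_conj:
  assumes A: "A \<in> psd_mats m" and V: "V \<in> unitary_mats m"
  shows "psd_power (V * A * mat_adjoint V) p = V * psd_power A p * mat_adjoint V"
proof -
  obtain U d where U: "U \<in> unitary_mats m" "A = diag_conj U d"
    using psd_spectral[OF A] by blast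
  then show ?thesis
    using diag_conj_conj[OF unitary_carrier[OF V] unitary_carrier[OF U(1)]]
    by (simp add: psd_power_diag_conj psd_power_diag_conj[OF unitary_mult[OF V U(1)]])
qed

lemma diag_conj_smult:
  assumes "U \<in> carrier_mat m m"
  shows "complex_of_real c \<cdot>\<^sub>m diag_conj U d = diag_conj U (\<lambda>i. c * d i)"
proof -
  have "complex_of_real c \<cdot>\<^sub>m diag_conj U d
    = U * (complex_of_real c \<cdot>\<^sub>m mat_diag m (\<lambda>i. complex_of_real (d i))) * mat_adjoint U"
    using assms by (simp add: diag_conj_def mult_smult_distrib[of _ m m _ m] mult_smult_assoc_mat[of _ m m _ m])
  then show ?thesis using assms by (simp add: diag_conj_def mat_diag_smult)
qed

lemma psd_power_smult:
  assumes A: "A \<in> psd_mats m" and c: "c \<ge> 0"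
  shows "psd_power (complex_of_real c \<cdot>\<^sub>m A) p = complex_of_real (c powr p) \<cdot>\<^sub>m psd_power A p"
proof -
  obtain U d where U: "U \<in> unitary_mats m" "A = diag_conj U d" "\<And>i. i < m \<Longrightarrow> 0 \<le> d i"
    using psd_spectral[OF A] by blast
  note cU = unitary_carrier[OF U(1)]
  show ?thesis
    unfolding U(2) diag_conj_smult[OF cU] psd_power_diag_conj[OF U(1)]
    by (rule diag_conj_cong[OF cU]) (simp add: powr_mult c U(3))
qed

text \<open>Jensen's inequality for the probability weights \<open>\<bar>\<langle>v, u i\<rangle>\<bar>\<^sup>2\<close> given by an eigenbasis \<open>u\<close> of \<open>A\<close>.\<close>

lemma quad_form_power_ge:
  assumes A: "A \<in> psd_mats m" and p: "p \<ge> 1" and v: "v \<in> carrier_vec m" "vec_norm_sq v = 1"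
  shows "quad_form A v powr p \<le> quad_form (psd_power A p) v"
proof -
  obtain U d where U: "U \<in> unitary_mats m" "A = diag_conj U d" "\<And>i. i < m \<Longrightarrow> 0 \<le> d i"
    using psd_spectral[OF A] by blast
  note cU = unitary_carrier[OF U(1)]
  define x where "x = (\<lambda>i. (cmod ((mat_adjoint U *\<^sub>v v) $ i))\<^sup>2)"
  have "(\<Sum>i<m. x i) = vec_norm_sq (mat_adjoint U *\<^sub>v v)"
    using cU by (simp add: x_def vec_norm_sq_def)
  then have x: "(\<Sum>i<m. x i) = 1"
    using vec_norm_sq_unitary[OF unitary_adjoint[OF U(1)] v(1)] v(2) by simp
  then have ne: "{..<m} \<noteq> {}" by auto
  have "(\<Sum>i<m. x i *\<^sub>R d i) powr p \<le> (\<Sum>i<m. x i * d i powr p)"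
    by (rule convex_on_sum[OF _ ne convex_on_powr[OF p] x]) (use U(3) in \<open>auto simp: x_def\<close>)
  then show ?thesis
    unfolding U(2) psd_power_diag_conj[OF U(1)] quad_form_diag_conj[OF cU v(1)]
    by (simp add: x_def mult.commute)
qed

text \<open>The number \<open>s t / (t + s) \<bar>a\<bar>\<^sup>2\<close> is the minimum over \<open>z\<close> of \<open>t \<bar>a - z\<bar>\<^sup>2 + s \<bar>z\<bar>\<^sup>2\<close>, attained at
  \<open>z = t / (t + s) a\<close>; this lemma gives the bound, the next one the value at the minimizer. This variational form makes resolvents comparable without
  inverting any matrix.\<close>

lemma resolvent_le:
  fixes a z :: complex and s t :: real
  assumes "s > 0" "t \<ge> 0"
  shows "s * (t / (t + s) * (cmod a)\<^sup>2) \<le> t * (cmod (a - z))\<^sup>2 + s * (cmod z)\<^sup>2"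
proof -
  have "(t + s) * (t * (cmod (a - z))\<^sup>2 + s * (cmod z)\<^sup>2) - s * t * (cmod a)\<^sup>2
      = (cmod (complex_of_real t * (a - z) - complex_of_real s * z))\<^sup>2"
    by (simp add: cmod_power2) (simp add: power2_eq_square algebra_simps)
  then have "s * t * (cmod a)\<^sup>2 \<le> (t + s) * (t * (cmod (a - z))\<^sup>2 + s * (cmod z)\<^sup>2)"
    by (metis diff_ge_0_iff_ge zero_le_power2)
  then show ?thesis using assms by (simp add: field_simps)
qed

lemma resolvent_eq:
  fixes b :: complex and s t :: real
  assumes "s > 0" "t \<ge> 0"
  defines "z \<equiv> complex_of_real (t / (t + s)) * b"
  shows "t * (cmod (b - z))\<^sup>2 + s * (cmod z)\<^sup>2 = s * (t / (t + s) * (cmod b)\<^sup>2)"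
proof -
  have ts: "t + s \<noteq> 0" using assms by auto
  have "b - z = complex_of_real (1 - t / (t + s)) * b" by (simp add: z_def algebra_simps)
  also have "1 - t / (t + s) = s / (t + s)" using ts by (simp add: field_simps)
  finally have bz: "b - z = complex_of_real (s / (t + s)) * b" .
  have "t * (cmod (b - z))\<^sup>2 + s * (cmod z)\<^sup>2
    = (t * (s / (t + s))\<^sup>2 + s * (t / (t + s))\<^sup>2) * (cmod b)\<^sup>2"
    unfolding bz unfolding z_def norm_mult norm_of_real power_mult_distrib power2_abs by (simp add: algebra_simps)
  also have "t * (s / (t + s))\<^sup>2 + s * (t / (t + s))\<^sup>2 = s * t * (t + s) / (t + s)\<^sup>2"
    by (simp add: power_divide add_divide_distrib[symmetric]) (simp add: power2_eq_square algebra_simps)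
  also have "\<dots> = s * (t / (t + s))" using ts by (simp add: power2_eq_square)
  finally show ?thesis by simp
qed

text \<open>For \<open>E = 1\<close> this is the Loewner-Heinz inequality \<open>T \<le> P \<Longrightarrow> T^p \<le> P^p\<close>, and for a projection \<open>E\<close> with \<open>P = E T E\<close> it is
  Hansen's inequality \<open>E T^p E \<le> (E T E)^p\<close>. Both follow in the same way: the form of \<open>s T / (T + s)\<close> at \<open>E v\<close> is the minimum over \<open>z\<close> of
  \<open>\<langle>T (E v - z), E v - z\<rangle> + s \<bar>z\<bar>\<^sup>2\<close>; restricting to \<open>z = E y\<close> with \<open>y\<close> the minimizer for \<open>P\<close> at \<open>v\<close> bounds it by the
  form of \<open>s P / (P + s)\<close> at \<open>v\<close>. The integral representation of \<open>t powr p\<close> then does the rest.\<close>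

lemma quad_form_power_le:
  assumes p: "0 < p" "p < 1" and T: "T \<in> psd_mats m" and P: "P \<in> psd_mats m"
    and E: "E \<in> carrier_mat m m"
    and contr: "\<And>v. v \<in> carrier_vec m \<Longrightarrow> vec_norm_sq (E *\<^sub>v v) \<le> vec_norm_sq v"
    and le: "\<And>v. v \<in> carrier_vec m \<Longrightarrow> quad_form T (E *\<^sub>v v) \<le> quad_form P v"
    and v: "v \<in> carrier_vec m"
  shows "quad_form (psd_power T p) (E *\<^sub>v v) \<le> quad_form (psd_power P p) v"
proof -
  obtain U d where U: "U \<in> unitary_mats m" "T = diag_conj U d" "\<And>i. i < m \<Longrightarrow> 0 \<le> d i"
    using psd_spectral[OF T] by blast
  obtain V e where V: "V \<in> unitary_mats m" "P = diag_conj V e" "\<And>i. i < m \<Longrightarrow> 0 \<le> e i"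
    using psd_spectral[OF P] by blast
  note cU = unitary_carrier[OF U(1)] and cV = unitary_carrier[OF V(1)]
  define a where "a = mat_adjoint U *\<^sub>v (E *\<^sub>v v)"
  define b where "b = mat_adjoint V *\<^sub>v v"
  have ab: "a \<in> carrier_vec m" "b \<in> carrier_vec m" using cU cV E v by (simp_all add: a_def b_def)
  have Ev: "E *\<^sub>v v \<in> carrier_vec m" using E v by simp
  have "(\<Sum>i<m. d i powr p * (cmod (a $ i))\<^sup>2) \<le> (\<Sum>j<m. e j powr p * (cmod (b $ j))\<^sup>2)"
  proof (rule powr_sum_le_of_resolvent_sum_le[OF p])
    fix s :: real assume s: "s > 0"
    \<comment> \<open>The coordinates, in the eigenbasis of \<open>P\<close>, of the minimizer \<open>y = P (P + s)\<inverse> v\<close>.\<close>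
    define c where "c = vec m (\<lambda>j. complex_of_real (e j / (e j + s)) * b $ j)"
    define y where "y = V *\<^sub>v c"
    define z where "z = mat_adjoint U *\<^sub>v (E *\<^sub>v y)"
    have c: "c \<in> carrier_vec m" by (simp add: c_def)
    have y: "y \<in> carrier_vec m" using cV c by (simp add: y_def)
    have Ey: "E *\<^sub>v y \<in> carrier_vec m" using E y by simp
    have z: "z \<in> carrier_vec m" using cU Ey by (simp add: z_def)
    have "mat_adjoint V *\<^sub>v y = (mat_adjoint V * V) *\<^sub>v c"
      using cV c by (simp add: y_def assoc_mult_mat_vec[of _ m m _ m])
    then have Vy: "mat_adjoint V *\<^sub>v y = c" using c by (simp add: unitary_cancel_left[OF V(1)])
    have E_diff: "E *\<^sub>v (v - y) = E *\<^sub>v v - E *\<^sub>v y"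
      using E v y by (simp add: mult_minus_distrib_mat_vec[of _ m m])
    have az: "mat_adjoint U *\<^sub>v (E *\<^sub>v (v - y)) = a - z"
      unfolding E_diff using cU Ev Ey by (simp add: a_def z_def mult_minus_distrib_mat_vec[of _ m m])
    have bc: "mat_adjoint V *\<^sub>v (v - y) = b - c"
      using cV v y Vy by (simp add: b_def mult_minus_distrib_mat_vec[of _ m m])
    have Evy: "E *\<^sub>v (v - y) \<in> carrier_vec m" "v - y \<in> carrier_vec m" using E v y by auto
    have "s * (\<Sum>i<m. d i / (d i + s) * (cmod (a $ i))\<^sup>2)
        \<le> (\<Sum>i<m. d i * (cmod ((a - z) $ i))\<^sup>2 + s * (cmod (z $ i))\<^sup>2)"
      unfolding sum_distrib_left using ab z resolvent_le[OF s U(3)] by (intro sum_mono) auto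
    also have "\<dots> = quad_form T (E *\<^sub>v (v - y)) + s * vec_norm_sq z"
      using z unfolding U(2) quad_form_diag_conj[OF cU Evy(1)] az
      by (simp add: sum.distrib vec_norm_sq_def sum_distrib_left)
    also have "vec_norm_sq z = vec_norm_sq (E *\<^sub>v y)"
      unfolding z_def by (rule vec_norm_sq_unitary[OF unitary_adjoint[OF U(1)] Ey])
    also have "quad_form T (E *\<^sub>v (v - y)) + s * vec_norm_sq (E *\<^sub>v y) \<le> quad_form P (v - y) + s * vec_norm_sq y"
      using s by (intro add_mono le[OF Evy(2)] mult_left_mono contr[OF y]) auto
    also have "vec_norm_sq y = vec_norm_sq c"
      unfolding y_def by (rule vec_norm_sq_unitary[OF V(1) c])
    also have "quad_form P (v - y) + s * vec_norm_sq c
        = (\<Sum>j<m. e j * (cmod (b $ j - c $ j))\<^sup>2 + s * (cmod (c $ j))\<^sup>2)"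
      using ab c unfolding V(2) quad_form_diag_conj[OF cV Evy(2)] bc
      by (simp add: sum.distrib vec_norm_sq_def sum_distrib_left)
    also have "\<dots> = (\<Sum>j<m. s * (e j / (e j + s) * (cmod (b $ j))\<^sup>2))"
      using resolvent_eq[OF s V(3)] by (intro sum.cong refl) (simp add: c_def)
    also have "\<dots> = s * (\<Sum>j<m. e j / (e j + s) * (cmod (b $ j))\<^sup>2)"
      by (simp only: sum_distrib_left)
    finally show "(\<Sum>i<m. d i / (d i + s) * (cmod (a $ i))\<^sup>2) \<le> (\<Sum>j<m. e j / (e j + s) * (cmod (b $ j))\<^sup>2)"
      using s by (simp only: mult_le_cancel_left_pos)
  qed (use U(3) V(3) in auto)
  then show ?thesis
    unfolding U(2) V(2) psd_power_diag_conj[OF U(1)] psd_power_diag_conj[OF V(1)]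
      quad_form_diag_conj[OF cU Ev] quad_form_diag_conj[OF cV v] a_def b_def .
qed

lemma psd_mult_adjoint:
  fixes Z :: "complex mat"
  assumes Z: "Z \<in> carrier_mat m m"
  shows "Z * mat_adjoint Z \<in> psd_mats m"
proof (rule psd_matsI)
  fix v :: "complex vec" assume v: "v \<in> carrier_vec m"
  have "mat_adjoint (mat_adjoint Z) * 1\<^sub>m m * mat_adjoint Z = Z * mat_adjoint Z" using Z by simp
  then have "quad_form (Z * mat_adjoint Z) v = quad_form (1\<^sub>m m) (mat_adjoint Z *\<^sub>v v)"
    using quad_form_congruence[of "1\<^sub>m m" m "mat_adjoint Z" v] Z v by simp
  also have "\<dots> = vec_norm_sq (mat_adjoint Z *\<^sub>v v)"
    using Z v by (simp add: quad_form_def cscalar_prod_self)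
  finally show "0 \<le> quad_form (Z * mat_adjoint Z) v" by (simp add: vec_norm_sq_nonneg)
qed (use Z in \<open>simp_all add: mat_adjoint_mult[of _ m m _ m]\<close>)

lemma psd_congruence:
  assumes A: "A \<in> psd_mats m" and E: "E \<in> carrier_mat m m"
  shows "mat_adjoint E * A * E \<in> psd_mats m"
proof (rule psd_matsI)
  note cA = psd_carrier[OF A]
  show "mat_adjoint E * A * E \<in> carrier_mat m m" using E cA by simp
  show "mat_adjoint (mat_adjoint E * A * E) = mat_adjoint E * A * E"
    using E cA psd_hermitian[OF A]
    by (simp add: mat_adjoint_mult[of _ m m _ m] assoc_mult_mat[of _ m m _ m _ m])
  fix v :: "complex vec" assume v: "v \<in> carrier_vec m"
  show "0 \<le> quad_form (mat_adjoint E * A * E) v"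
    using psd_quad_form[OF A, of "E *\<^sub>v v"] E v by (simp only: quad_form_congruence[OF cA E v] square_mat_simps)
qed

section \<open>Norms of powers\<close>

text \<open>The constant in the quasi-triangle inequality \<open>(a + b) powr p \<le> c * (a powr p + b powr p)\<close> for \<open>a, b \<ge> 0\<close>.\<close>

definition quasi_const :: "real \<Rightarrow> real" where
  "quasi_const p = max 1 (2 powr (p - 1))"

lemma quasi_const_pos: "quasi_const p > 0"
  by (simp add: quasi_const_def)

context
  fixes m :: nat and N :: "complex mat \<Rightarrow> real"
  assumes N: "symmetric_norm m N"
begin

text \<open>For \<open>p < 1\<close> this is the Loewner-Heinz inequality. For \<open>p > 1\<close> the power is not operator monotone, but by Jensen's inequality the
  diagonal of \<open>T^p\<close> in an eigenbasis of \<open>P\<close> dominates the eigenvalues of \<open>P^p\<close>, which suffices for the norm.\<close>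

lemma norm_power_mono:
  assumes p: "p > 0" and P: "P \<in> psd_mats m" and T: "T \<in> psd_mats m"
    and le: "\<And>v. v \<in> carrier_vec m \<Longrightarrow> quad_form P v \<le> quad_form T v"
  shows "N (psd_power P p) \<le> N (psd_power T p)"
proof (cases "p \<ge> 1")
  case True
  obtain U d where U: "U \<in> unitary_mats m" "P = diag_conj U d" "\<And>i. i < m \<Longrightarrow> 0 \<le> d i"
    using psd_spectral[OF P] by blast
  have "d i powr p \<le> quad_form (psd_power T p) (col U i)" if i: "i < m" for i
  proof -
    have c: "col U i \<in> carrier_vec m" using unitary_carrier[OF U(1)] by auto
    have "d i \<le> quad_form T (col U i)"
      using le[OF c] quad_form_diag_conj_col[OF U(1) i, of d] U(2) by simp
    then have "d i powr p \<le> quad_form T (col U i) powr p"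
      using U(3)[OF i] p by (intro powr_mono2) auto
    also have "\<dots> \<le> quad_form (psd_power T p) (col U i)"
      by (rule quad_form_power_ge[OF T True c vec_norm_sq_col[OF U(1) i]])
    finally show ?thesis .
  qed
  then show ?thesis
    unfolding U(2) psd_power_diag_conj[OF U(1)]
    by (intro norm_diag_conj_le[OF N U(1) psd_power_carrier[OF T]]) auto
next
  case False
  show ?thesis
  proof (rule norm_mono[OF N psd_power_psd[OF P] psd_power_carrier[OF T]])
    fix v :: "complex vec" assume v: "v \<in> carrier_vec m"
    show "quad_form (psd_power P p) v \<le> quad_form (psd_power T p) v"
      using quad_form_power_le[of p P m T "1\<^sub>m m" v] False p P T le v by simp
  qed
qed

text \<open>The matrices \<open>G q Q = T^(q/2) Q\<close> split \<open>T^q\<close> as \<open>G G\<^sup>*\<close> for \<open>Q = E\<close> plus the same for \<open>Q = F\<close>, while \<open>G\<^sup>* G\<close> is the compression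
  \<open>Q T^q Q\<close>. For \<open>p \<ge> 1\<close> the splitting of \<open>T\<close> itself is used, since powers of the summands can be
  compared by convexity; for \<open>p < 1\<close> the splitting of \<open>T^p\<close> is used, since there compression and power can be
  exchanged by Hansen's inequality.\<close>

lemma norm_power_projections:
  assumes p: "p > 0" and T: "T \<in> psd_mats m"
    and E: "E \<in> carrier_mat m m" "mat_adjoint E = E" "E * E = E"
    and F: "F \<in> carrier_mat m m" "mat_adjoint F = F" "F * F = F"
    and EF: "E + F = 1\<^sub>m m"
  shows "N (psd_power T p)
    \<le> quasi_const p * (N (psd_power (E * T * E) p) + N (psd_power (F * T * F) p))"
proof -
  define G where "G = (\<lambda>q Q. psd_power T (q / 2) * Q)"
  have cT: "psd_power T q \<in> carrier_mat m m" for q by (rule psd_power_carrier[OF T])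
  have hT: "mat_adjoint (psd_power T q) = psd_power T q" for q
    by (rule psd_hermitian[OF psd_power_psd[OF T]])
  have G: "G q Q \<in> carrier_mat m m"
    and GG: "G q Q * mat_adjoint (G q Q) = psd_power T (q / 2) * Q * psd_power T (q / 2)"
    and G'G: "mat_adjoint (G q Q) * G q Q = Q * psd_power T q * Q"
    if Q: "Q \<in> carrier_mat m m" "mat_adjoint Q = Q" "Q * Q = Q" for q Q
  proof -
    show "G q Q \<in> carrier_mat m m" using cT Q by (simp add: G_def)
    have "G q Q * mat_adjoint (G q Q) = psd_power T (q / 2) * (Q * Q) * psd_power T (q / 2)"
      unfolding G_def using Q(1,2) cT hT
      by (simp add: mat_adjoint_mult[of _ m m _ m] assoc_mult_mat[of _ m m _ m _ m])
    then show "G q Q * mat_adjoint (G q Q) = psd_power T (q / 2) * Q * psd_power T (q / 2)"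
      by (simp only: Q(3))
    have "mat_adjoint (G q Q) * G q Q = Q * (psd_power T (q / 2) * psd_power T (q / 2)) * Q"
      unfolding G_def using Q(1,2) cT hT
      by (simp add: mat_adjoint_mult[of _ m m _ m] assoc_mult_mat[of _ m m _ m _ m])
    then show "mat_adjoint (G q Q) * G q Q = Q * psd_power T q * Q"
      by (simp add: psd_power_mult[OF T])
  qed
  have split: "psd_power T q = G q E * mat_adjoint (G q E) + G q F * mat_adjoint (G q F)" for q
  proof -
    let ?R = "psd_power T (q / 2)"
    have "psd_power T q = ?R * (E + F) * ?R"
      unfolding EF using cT by (simp add: psd_power_mult[OF T])
    also have "\<dots> = ?R * E * ?R + ?R * F * ?R"
      using cT E F by (simp add: mult_add_distrib_mat[of _ m m _ m] add_mult_distrib_mat[of _ m m _ _ m])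
    finally show ?thesis by (simp only: GG[OF E] GG[OF F])
  qed
  show ?thesis
  proof (cases "p \<ge> 1")
    case True
    define P where "P = (\<lambda>Q. G 1 Q * mat_adjoint (G 1 Q))"
    have P: "P E \<in> psd_mats m" "P F \<in> psd_mats m"
      unfolding P_def by (intro psd_mult_adjoint G E F)+
    have NP: "N (psd_power (P Q) p) = N (psd_power (Q * T * Q) p)"
      if Q: "Q \<in> carrier_mat m m" "mat_adjoint Q = Q" "Q * Q = Q" for Q
      using norm_power_mult_adjoint(1)[OF N G[OF Q, of 1], of p]
      by (simp add: P_def G'G[OF Q] psd_power_1[OF T])
    have T_split: "T = P E + P F"
      using split[of 1] by (simp add: P_def psd_power_1[OF T])
    define Z where "Z = complex_of_real (2 powr (p - 1)) \<cdot>\<^sub>m (psd_power (P E) p + psd_power (P F) p)"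
    have cP: "psd_power (P E) p \<in> carrier_mat m m" "psd_power (P F) p \<in> carrier_mat m m"
      using P by (simp_all add: psd_power_carrier)
    obtain U d where U: "U \<in> unitary_mats m" "T = diag_conj U d" "\<And>i. i < m \<Longrightarrow> 0 \<le> d i"
      using psd_spectral[OF T] by blast
    have "d i powr p \<le> quad_form Z (col U i)" if i: "i < m" for i
    proof -
      have c: "col U i \<in> carrier_vec m" using unitary_carrier[OF U(1)] by auto
      have "d i = quad_form T (col U i)"
        using quad_form_diag_conj_col[OF U(1) i, of d] U(2) by simp
      also have "\<dots> = quad_form (P E) (col U i) + quad_form (P F) (col U i)"
        unfolding T_split by (rule quad_form_add[OF psd_carrier[OF P(1)] psd_carrier[OF P(2)] c])
      finally have "d i powr p
        \<le> 2 powr (p - 1) * (quad_form (P E) (col U i) powr p + quad_form (P F) (col U i) powr p)"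
        using powr_add_le[OF True psd_quad_form[OF P(1) c] psd_quad_form[OF P(2) c]] by simp
      also have "\<dots> \<le> 2 powr (p - 1)
          * (quad_form (psd_power (P E) p) (col U i) + quad_form (psd_power (P F) p) (col U i))"
        using P c vec_norm_sq_col[OF U(1) i] by (intro mult_left_mono add_mono quad_form_power_ge[OF _ True]) auto
      also have "\<dots> = quad_form Z (col U i)"
        unfolding Z_def using cP c by (simp only: quad_form_smult[OF add_carrier_mat] quad_form_add[OF cP c])
      finally show ?thesis .
    qed
    then have "N (psd_power T p) \<le> N Z"
      unfolding U(2) psd_power_diag_conj[OF U(1)]
      using cP by (intro norm_diag_conj_le[OF N U(1)]) (auto simp: Z_def)
    also have "\<dots> = 2 powr (p - 1) * N (psd_power (P E) p + psd_power (P F) p)"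
      unfolding Z_def using cP by (intro norm_smult[OF N]) auto
    also have "\<dots> \<le> 2 powr (p - 1) * (N (psd_power (P E) p) + N (psd_power (P F) p))"
      by (intro mult_left_mono norm_add[OF N] cP) auto
    also have "2 powr (p - 1) = quasi_const p"
      using True by (simp add: quasi_const_def max_def ge_one_powr_ge_zero)
    finally show ?thesis by (simp only: NP[OF E] NP[OF F])
  next
    case False
    \<comment> \<open>A projection contracts: \<open>\<bar>v\<bar>\<^sup>2 = \<bar>Q v\<bar>\<^sup>2 + \<bar>R v\<bar>\<^sup>2\<close> for complementary projections.\<close>
    have contr: "vec_norm_sq (Q *\<^sub>v v) \<le> vec_norm_sq v"
      if Q: "Q \<in> carrier_mat m m" "mat_adjoint Q = Q" "Q * Q = Q"
        and R: "R \<in> carrier_mat m m" "mat_adjoint R = R" "R * R = R" and QR: "Q + R = 1\<^sub>m m"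
        and v: "v \<in> carrier_vec m" for Q R v
    proof -
      have proj: "quad_form S v = vec_norm_sq (S *\<^sub>v v)"
        if S: "S \<in> carrier_mat m m" "mat_adjoint S = S" "S * S = S" for S
      proof -
        have "quad_form S v = quad_form (1\<^sub>m m) (S *\<^sub>v v)"
          using quad_form_congruence[of "1\<^sub>m m" m S v] S v by simp
        then show ?thesis using S v by (simp add: quad_form_def cscalar_prod_self)
      qed
      have "vec_norm_sq v = quad_form (Q + R) v"
        unfolding QR using v by (simp add: quad_form_def cscalar_prod_self)
      also have "\<dots> = vec_norm_sq (Q *\<^sub>v v) + vec_norm_sq (R *\<^sub>v v)"
        unfolding quad_form_add[OF Q(1) R(1) v] by (simp only: proj[OF Q] proj[OF R])
      finally show ?thesis using vec_norm_sq_nonneg[of "R *\<^sub>v v"] by simp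
    qed
    have NG: "N (G p Q * mat_adjoint (G p Q)) \<le> N (psd_power (Q * T * Q) p)"
      if Q: "Q \<in> carrier_mat m m" "mat_adjoint Q = Q" "Q * Q = Q"
        and c: "\<And>v. v \<in> carrier_vec m \<Longrightarrow> vec_norm_sq (Q *\<^sub>v v) \<le> vec_norm_sq v" for Q
    proof -
      have QTQ: "Q * S * Q \<in> psd_mats m" if "S \<in> psd_mats m" for S
        using psd_congruence[OF that Q(1)] Q(2) by simp
      have q: "quad_form (Q * S * Q) v = quad_form S (Q *\<^sub>v v)"
        if "S \<in> psd_mats m" "v \<in> carrier_vec m" for S v
        using quad_form_congruence[OF psd_carrier[OF that(1)] Q(1) that(2)] Q(2) by simp
      have "N (G p Q * mat_adjoint (G p Q)) = N (Q * psd_power T p * Q)"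
        using norm_power_mult_adjoint(2)[OF N G[OF Q, of p]] by (simp only: G'G[OF Q])
      also have "\<dots> \<le> N (psd_power (Q * T * Q) p)"
      proof (rule norm_mono[OF N QTQ[OF psd_power_psd[OF T]] psd_power_carrier[OF QTQ[OF T]]])
        fix v :: "complex vec" assume v: "v \<in> carrier_vec m"
        have "quad_form (psd_power T p) (Q *\<^sub>v v) \<le> quad_form (psd_power (Q * T * Q) p) v"
          using False p by (intro quad_form_power_le[OF _ _ T QTQ[OF T] Q(1) c _ v]) (auto simp: q[OF T])
        then show "quad_form (Q * psd_power T p * Q) v \<le> quad_form (psd_power (Q * T * Q) p) v"
          by (simp only: q[OF psd_power_psd[OF T] v])
      qed
      finally show ?thesis .
    qed
    have FE: "F + E = 1\<^sub>m m" using EF E(1) F(1) by (metis comm_add_mat)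
    have "N (psd_power T p) \<le> N (G p E * mat_adjoint (G p E)) + N (G p F * mat_adjoint (G p F))"
      unfolding split[of p] using G[OF E, of p] G[OF F, of p] by (intro norm_add[OF N]) auto
    also have "\<dots> \<le> N (psd_power (E * T * E) p) + N (psd_power (F * T * F) p)"
      by (intro add_mono NG E F contr[OF E F EF] contr[OF F E FE])
    also have "\<dots> = quasi_const p * (N (psd_power (E * T * E) p) + N (psd_power (F * T * F) p))"
    proof -
      have "2 powr (p - 1) \<le> 2 powr (0::real)" using False by (intro powr_mono) auto
      then show ?thesis by (simp add: quasi_const_def)
    qed
    finally show ?thesis .
  qed
qed

end

section \<open>Block matrices and the induced norm\<close>

abbreviation pad :: "nat \<Rightarrow> complex mat \<Rightarrow> complex mat" where
  "pad n Z \<equiv> four_block_mat Z (0\<^sub>m n n) (0\<^sub>m n n) (0\<^sub>m n n)"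

lemma pad_carrier: "Z \<in> carrier_mat n n \<Longrightarrow> pad n Z \<in> carrier_mat (n + n) (n + n)"
  by auto

lemma square_block_mult:
  fixes A1 :: "complex mat"
  assumes "A1 \<in> carrier_mat n n" "B1 \<in> carrier_mat n n" "C1 \<in> carrier_mat n n" "D1 \<in> carrier_mat n n"
    "A2 \<in> carrier_mat n n" "B2 \<in> carrier_mat n n" "C2 \<in> carrier_mat n n" "D2 \<in> carrier_mat n n"
  shows "four_block_mat A1 B1 C1 D1 * four_block_mat A2 B2 C2 D2
    = four_block_mat (A1 * A2 + B1 * C2) (A1 * B2 + B1 * D2) (C1 * A2 + D1 * C2) (C1 * B2 + D1 * D2)"
  using assms by (intro mult_four_block_mat) auto

lemma square_zero_simps:
  fixes A :: "complex mat"
  assumes "A \<in> carrier_mat n n"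
  shows "0\<^sub>m n n * A = 0\<^sub>m n n" "A * 0\<^sub>m n n = 0\<^sub>m n n" "0\<^sub>m n n + A = A" "A + 0\<^sub>m n n = A"
  using assms by auto

text \<open>The padded zeros are eigenvalues \<open>0\<close>, with the last \<open>n\<close> unit vectors as eigenvectors.\<close>

lemma pad_diag_conj:
  assumes U: "U \<in> unitary_mats n"
  obtains V where "V \<in> unitary_mats (n + n)"
    "\<And>d. pad n (diag_conj U d) = diag_conj V (\<lambda>i. if i < n then d i else 0)"
proof
  define V where "V = four_block_mat U (0\<^sub>m n n) (0\<^sub>m n n) (1\<^sub>m n)"
  note c = unitary_carrier[OF U]
  show V: "V \<in> unitary_mats (n + n)" unfolding V_def by (rule unitary_four_block[OF U unitary_one])
  fix d :: "nat \<Rightarrow> real"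
  have "mat_diag (n + n) (\<lambda>i. complex_of_real (if i < n then d i else 0))
      = four_block_mat (mat_diag n (\<lambda>i. complex_of_real (d i))) (0\<^sub>m n n) (0\<^sub>m n n) (0\<^sub>m n n)"
    by (rule eq_matI) (auto simp: mat_diag_def)
  then show "pad n (diag_conj U d) = diag_conj V (\<lambda>i. if i < n then d i else 0)"
    using c unitary_carrier[OF V]
    by (simp add: diag_conj_def V_def mat_adjoint_four_block[of _ n n _ n _ n] square_block_mult[where n = n] square_zero_simps[where n = n])
qed

lemma psd_power_pad:
  assumes A: "A \<in> psd_mats n"
  shows "psd_power (pad n A) p = pad n (psd_power A p)"
proof -
  obtain U d where U: "U \<in> unitary_mats n" "A = diag_conj U d"
    using psd_spectral[OF A] by blast
  obtain V where V: "V \<in> unitary_mats (n + n)"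
    "\<And>d. pad n (diag_conj U d) = diag_conj V (\<lambda>i. if i < n then d i else 0)"
    using pad_diag_conj[OF U(1)] by blast
  show ?thesis
    unfolding U(2) psd_power_diag_conj[OF U(1)] V(2) psd_power_diag_conj[OF V(1)]
    by (rule diag_conj_cong[OF unitary_carrier[OF V(1)]]) simp
qed

lemma pad_psd:
  assumes "A \<in> psd_mats n"
  shows "pad n A \<in> psd_mats (n + n)"
proof -
  obtain U d where U: "U \<in> unitary_mats n" "A = diag_conj U d" "\<And>i. i < n \<Longrightarrow> 0 \<le> d i"
    using psd_spectral[OF assms] by blast
  obtain V where V: "V \<in> unitary_mats (n + n)"
    "\<And>d. pad n (diag_conj U d) = diag_conj V (\<lambda>i. if i < n then d i else 0)"
    using pad_diag_conj[OF U(1)] by blast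
  show ?thesis
    unfolding U(2) V(2) using U(3) by (intro diag_conj_psd unitary_carrier[OF V(1)]) auto
qed

lemma psd_diagonal_block:
  assumes M: "four_block_mat A B C D \<in> psd_mats (n + n)"
    and c: "A \<in> carrier_mat n n" "B \<in> carrier_mat n n" "C \<in> carrier_mat n n" "D \<in> carrier_mat n n"
  shows "A \<in> psd_mats n" "D \<in> psd_mats n"
proof -
  let ?M = "four_block_mat A B C D"
  have "four_block_mat (mat_adjoint A) (mat_adjoint C) (mat_adjoint B) (mat_adjoint D) = ?M"
    using psd_hermitian[OF M] c by (simp add: mat_adjoint_four_block[of _ n n _ n _ n])
  then have idx: "four_block_mat (mat_adjoint A) (mat_adjoint C) (mat_adjoint B) (mat_adjoint D) $$ (i, j)
      = ?M $$ (i, j)" for i j by simp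
  have hA: "mat_adjoint A = A"
  proof (rule eq_matI)
    fix i j assume "i < dim_row A" "j < dim_col A"
    then show "mat_adjoint A $$ (i, j) = A $$ (i, j)" using idx[of i j] c by simp
  qed (use c in auto)
  have hD: "mat_adjoint D = D"
  proof (rule eq_matI)
    fix i j assume "i < dim_row D" "j < dim_col D"
    then show "mat_adjoint D $$ (i, j) = D $$ (i, j)" using idx[of "n + i" "n + j"] c by simp
  qed (use c in auto)
  have q: "quad_form ?M (v @\<^sub>v w) = Re ((A *\<^sub>v v + B *\<^sub>v w) \<bullet>c v) + Re ((C *\<^sub>v v + D *\<^sub>v w) \<bullet>c w)"
    if v: "v \<in> carrier_vec n" and w: "w \<in> carrier_vec n" for v w
  proof -
    have "conjugate (v @\<^sub>v w) = conjugate v @\<^sub>v conjugate w"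
      using v w by (intro eq_vecI) auto
    then show ?thesis
      unfolding quad_form_def four_block_mat_mult_vec[OF c v w]
      using c v w by (simp add: scalar_prod_append[of _ n _ n])
  qed
  have z: "Z *\<^sub>v 0\<^sub>v n = 0\<^sub>v n" if "Z \<in> carrier_mat n n" for Z :: "complex mat"
    using that by (intro eq_vecI) auto
  show "A \<in> psd_mats n"
  proof (rule psd_matsI[OF c(1) hA])
    fix v :: "complex vec" assume v: "v \<in> carrier_vec n"
    have "0 \<le> quad_form ?M (v @\<^sub>v 0\<^sub>v n)" using v by (intro psd_quad_form[OF M]) auto
    then show "0 \<le> quad_form A v"
      using c v by (simp add: q[OF v zero_carrier_vec] z) (simp add: quad_form_def)
  qed
  show "D \<in> psd_mats n"
  proof (rule psd_matsI[OF c(4) hD])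
    fix v :: "complex vec" assume v: "v \<in> carrier_vec n"
    have "0 \<le> quad_form ?M (0\<^sub>v n @\<^sub>v v)" using v by (intro psd_quad_form[OF M]) auto
    then show "0 \<le> quad_form D v"
      using c v by (simp add: q[OF zero_carrier_vec v] z) (simp add: quad_form_def)
  qed
qed

lemma psd_add:
  assumes "A \<in> psd_mats n" "B \<in> psd_mats n"
  shows "A + B \<in> psd_mats n"
proof (rule psd_matsI)
  note c = psd_carrier[OF assms(1)] psd_carrier[OF assms(2)]
  show "A + B \<in> carrier_mat n n" using c by auto
  show "mat_adjoint (A + B) = A + B"
    using c assms by (simp add: mat_adjoint_add[OF c] psd_hermitian)
  show "0 \<le> quad_form (A + B) v" if "v \<in> carrier_vec n" for v
    unfolding quad_form_add[OF c that] using assms that by (simp add: psd_quad_form)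
qed

lemma psd_smult:
  assumes A: "A \<in> psd_mats n" and "0 \<le> r"
  shows "complex_of_real r \<cdot>\<^sub>m A \<in> psd_mats n"
proof -
  obtain U d where U: "U \<in> unitary_mats n" "A = diag_conj U d" "\<And>i. i < n \<Longrightarrow> 0 \<le> d i"
    using psd_spectral[OF A] by blast
  then show ?thesis
    using assms unitary_carrier[OF U(1)] by (auto simp: diag_conj_smult intro!: diag_conj_psd)
qed

context
  fixes n :: nat and N :: "complex mat \<Rightarrow> real"
  assumes N: "symmetric_norm (n + n) N"
begin

text \<open>Hence every result on symmetric norms also applies to the induced norm on the smaller matrices.\<close>

lemma symmetric_norm_induced: "symmetric_norm n (induced_norm n N)"
  unfolding symmetric_norm_def
proof (intro conjI ballI allI)
  fix Z :: "complex mat" assume Z: "Z \<in> carrier_mat n n"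
  note pZ = pad_carrier[OF Z]
  show "0 \<le> induced_norm n N Z"
    using N pZ by (simp add: symmetric_norm_def induced_norm_def)
  have "pad n Z = 0\<^sub>m (n + n) (n + n) \<longleftrightarrow> Z = 0\<^sub>m n n"
  proof
    assume eq: "pad n Z = 0\<^sub>m (n + n) (n + n)"
    show "Z = 0\<^sub>m n n"
    proof (rule eq_matI)
      fix i j assume "i < dim_row (0\<^sub>m n n :: complex mat)" "j < dim_col (0\<^sub>m n n :: complex mat)"
      then show "Z $$ (i, j) = 0\<^sub>m n n $$ (i, j)"
        using arg_cong[OF eq, of "\<lambda>M. M $$ (i, j)"] Z by simp
    qed (use Z in auto)
  qed (auto intro: eq_matI)
  then show "induced_norm n N Z = 0 \<longleftrightarrow> Z = 0\<^sub>m n n"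
    using N pZ by (simp add: symmetric_norm_def induced_norm_def)
  show "induced_norm n N (c \<cdot>\<^sub>m Z) = cmod c * induced_norm n N Z" for c
  proof -
    have "pad n (c \<cdot>\<^sub>m Z) = c \<cdot>\<^sub>m pad n Z" using Z by (intro eq_matI) auto
    then show ?thesis using N pZ by (simp add: symmetric_norm_def induced_norm_def)
  qed
  show "induced_norm n N (Z + Y) \<le> induced_norm n N Z + induced_norm n N Y"
    if Y: "Y \<in> carrier_mat n n" for Y
  proof -
    have "pad n (Z + Y) = pad n Z + pad n Y" using Z Y by (intro eq_matI) auto
    then show ?thesis using norm_add[OF N pZ pad_carrier[OF Y]] by (simp add: induced_norm_def)
  qed
  fix U :: "complex mat" assume U: "U \<in> unitary_mats n"
  note cU = unitary_carrier[OF U]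
  let ?V = "four_block_mat U (0\<^sub>m n n) (0\<^sub>m n n) (1\<^sub>m n)"
  have V: "?V \<in> unitary_mats (n + n)" by (rule unitary_four_block[OF U unitary_one])
  have "pad n (U * Z) = ?V * pad n Z" "pad n (Z * U) = pad n Z * ?V"
    using Z cU by (simp_all add: square_block_mult[where n = n] square_zero_simps[where n = n])
  then show "induced_norm n N (U * Z) = induced_norm n N Z" "induced_norm n N (Z * U) = induced_norm n N Z"
    using norm_unitary_left[OF N pZ V] norm_unitary_right[OF N pZ V] by (simp_all add: induced_norm_def)
qed

lemma norm_power_block_le:
  assumes p: "p > 0" and M: "four_block_mat P R S Q \<in> psd_mats (n + n)"
    and c: "P \<in> carrier_mat n n" "R \<in> carrier_mat n n" "S \<in> carrier_mat n n" "Q \<in> carrier_mat n n"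
  shows "N (psd_power (four_block_mat P R S Q) p)
    \<le> quasi_const p * (induced_norm n N (psd_power P p) + induced_norm n N (psd_power Q p))"
proof -
  let ?M = "four_block_mat P R S Q"
  let ?one = "1\<^sub>m n :: complex mat" and ?zero = "0\<^sub>m n n :: complex mat"
  define E where "E = four_block_mat ?one ?zero ?zero ?zero"
  define F where "F = four_block_mat ?zero ?zero ?zero ?one"
  \<comment> \<open>Exchanging the two blocks moves \<open>Q\<close> to the upper left corner, where the induced norm looks.\<close>
  define J where "J = four_block_mat ?zero ?one ?one ?zero"
  note PQ = psd_diagonal_block[OF M c]
  have E: "E \<in> carrier_mat (n + n) (n + n)" "mat_adjoint E = E" "E * E = E"
    by (auto simp: E_def mat_adjoint_four_block[of _ n n _ n _ n] square_block_mult[where n = n] square_zero_simps[where n = n])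
  have F: "F \<in> carrier_mat (n + n) (n + n)" "mat_adjoint F = F" "F * F = F"
    by (auto simp: F_def mat_adjoint_four_block[of _ n n _ n _ n] square_block_mult[where n = n] square_zero_simps[where n = n])
  have EF: "E + F = 1\<^sub>m (n + n)"
    by (rule eq_matI) (auto simp: E_def F_def)
  have J: "J \<in> unitary_mats (n + n)" "mat_adjoint J = J"
  proof -
    show J': "mat_adjoint J = J"
      by (simp add: J_def mat_adjoint_four_block[of _ n n _ n _ n])
    have "J * J = 1\<^sub>m (n + n)"
      by (simp add: J_def square_block_mult[where n = n] square_zero_simps[where n = n])
    then show "J \<in> unitary_mats (n + n)" using J' by (intro unitary_matsI) (auto simp: J_def)
  qed
  have EME: "E * ?M * E = pad n P"
    using c by (simp add: E_def square_block_mult[where n = n] square_zero_simps[where n = n])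
  have FMF: "F * ?M * F = J * pad n Q * mat_adjoint J"
    unfolding J(2) using c by (simp add: F_def J_def square_block_mult[where n = n] square_zero_simps[where n = n])
  have "N (psd_power (F * ?M * F) p) = N (psd_power (pad n Q) p)"
    unfolding FMF psd_power_unitary_conj[OF pad_psd[OF PQ(2)] J(1)]
    by (rule norm_conj[OF N psd_power_carrier[OF pad_psd[OF PQ(2)]] J(1)])
  then show ?thesis
    using norm_power_projections[OF N p M E F EF] PQ
    by (simp add: EME psd_power_pad induced_norm_def)
qed

text \<open>The sum \<open>A + B\<close> appears as \<open>Z\<^sup>* Z\<close> for a block column \<open>Z\<close> for which \<open>Z Z\<^sup>*\<close> has the diagonal blocks \<open>A\<close> and \<open>B\<close>.\<close>

lemma induced_norm_power_add:
  assumes p: "p > 0" and A: "A \<in> psd_mats n" and B: "B \<in> psd_mats n"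
  shows "induced_norm n N (psd_power (A + B) p)
    \<le> quasi_const p * (induced_norm n N (psd_power A p) + induced_norm n N (psd_power B p))"
proof -
  let ?zero = "0\<^sub>m n n :: complex mat"
  define G H where "G = psd_power A (1/2)" and "H = psd_power B (1/2)"
  have c: "G \<in> carrier_mat n n" "H \<in> carrier_mat n n"
    using A B by (simp_all add: G_def H_def psd_power_carrier)
  have h: "mat_adjoint G = G" "mat_adjoint H = H"
    by (simp_all add: G_def H_def psd_hermitian[OF psd_power_psd[OF A]] psd_hermitian[OF psd_power_psd[OF B]])
  have sq: "G * G = A" "H * H = B"
    by (simp_all add: G_def H_def psd_power_mult[OF A] psd_power_mult[OF B] psd_power_1[OF A] psd_power_1[OF B])
  define Z where "Z = four_block_mat G ?zero H ?zero"
  have Z: "Z \<in> carrier_mat (n + n) (n + n)" using c by (auto simp: Z_def)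
  have aZ: "mat_adjoint Z = four_block_mat G H ?zero ?zero"
    using c h by (simp add: Z_def mat_adjoint_four_block[of _ n n _ n _ n])
  have ZZ: "Z * mat_adjoint Z = four_block_mat A (G * H) (H * G) B"
    unfolding aZ using c psd_carrier[OF A] psd_carrier[OF B]
    by (simp add: Z_def square_block_mult[where n = n] square_zero_simps[where n = n] sq)
  have Z'Z: "mat_adjoint Z * Z = pad n (A + B)"
    unfolding aZ using c psd_carrier[OF A] psd_carrier[OF B]
    by (simp add: Z_def square_block_mult[where n = n] square_zero_simps[where n = n] sq)
  have "induced_norm n N (psd_power (A + B) p) = N (psd_power (mat_adjoint Z * Z) p)"
    unfolding Z'Z by (simp add: psd_power_pad psd_add A B induced_norm_def)
  also have "\<dots> = N (psd_power (Z * mat_adjoint Z) p)"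
    by (rule norm_power_mult_adjoint(1)[OF N Z, symmetric])
  also have "\<dots> \<le> quasi_const p * (induced_norm n N (psd_power A p) + induced_norm n N (psd_power B p))"
    using psd_mult_adjoint[OF Z] psd_carrier[OF A] psd_carrier[OF B] c unfolding ZZ
    by (intro norm_power_block_le[OF p]) auto
  finally show ?thesis .
qed

end

section \<open>The main estimate\<close>

text \<open>Conjugating with \<open>J\<close> averages \<open>A\<close> and \<open>B\<close> and moves the skew-Hermitian part of \<open>X\<close> into the diagonal blocks. Since
  the block estimate depends on the diagonal blocks only, \<open>R\<close> and \<open>S\<close> are left unspecified.\<close>

lemma block_rotation:
  fixes A B X :: "complex mat"
  assumes c: "A \<in> carrier_mat n n" "B \<in> carrier_mat n n" "X \<in> carrier_mat n n"
  defines "Y \<equiv> X - mat_adjoint X"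
  obtains J R S where "J \<in> unitary_mats (n + n)" "R \<in> carrier_mat n n" "S \<in> carrier_mat n n"
    "J * four_block_mat A X (mat_adjoint X) B * mat_adjoint J
      = four_block_mat ((1/2) \<cdot>\<^sub>m (A + B) + (- \<i> / 2) \<cdot>\<^sub>m Y) R S ((1/2) \<cdot>\<^sub>m (A + B) + (\<i> / 2) \<cdot>\<^sub>m Y)"
proof -
  define s where "s = complex_of_real (1 / sqrt 2)"
  have ss: "s * s = 1/2" and cnj_s: "cnj s = s"
    by (simp_all add: s_def flip: of_real_mult)
  have iss: "\<i> * s * (\<i> * s) = - 1 / 2"
  proof -
    have "\<i> * s * (\<i> * s) = (\<i> * \<i>) * (s * s)" by (simp only: mult_ac)
    then show ?thesis by (simp add: ss)
  qed
  let ?one = "1\<^sub>m n :: complex mat"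
  have scalar: "(a \<cdot>\<^sub>m ?one) * M = a \<cdot>\<^sub>m M" "M * (a \<cdot>\<^sub>m ?one) = a \<cdot>\<^sub>m M"
    if "M \<in> carrier_mat n n" for a M
    using that by (simp_all add: mult_smult_assoc_mat[of _ n n _ n] mult_smult_distrib[of _ n n _ n])
  have c_scalar: "a \<cdot>\<^sub>m ?one \<in> carrier_mat n n" for a by (rule smult_carrier_mat) simp
  have cX': "mat_adjoint X \<in> carrier_mat n n" using c by simp
  define J where "J = four_block_mat (s \<cdot>\<^sub>m ?one) ((\<i> * s) \<cdot>\<^sub>m ?one) ((\<i> * s) \<cdot>\<^sub>m ?one) (s \<cdot>\<^sub>m ?one)"
  have cJ: "J \<in> carrier_mat (n + n) (n + n)" using c_scalar by (auto simp: J_def)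
  have "mat_adjoint (a \<cdot>\<^sub>m ?one) = cnj a \<cdot>\<^sub>m ?one" for a
    by (rule eq_matI) auto
  then have aJ: "mat_adjoint J
      = four_block_mat (s \<cdot>\<^sub>m ?one) ((- \<i> * s) \<cdot>\<^sub>m ?one) ((- \<i> * s) \<cdot>\<^sub>m ?one) (s \<cdot>\<^sub>m ?one)"
    unfolding J_def using c_scalar
    by (subst mat_adjoint_four_block[of _ n n _ n _ n]) (simp_all add: cnj_s)
  have "mat_adjoint J * J = 1\<^sub>m (n + n)"
    unfolding aJ unfolding J_def
    by (subst square_block_mult[where n = n], (rule c_scalar)+, unfold scalar[OF c_scalar], rule eq_matI)
       (auto simp: ss iss)
  then have J: "J \<in> unitary_mats (n + n)" by (rule unitary_matsI[OF cJ])
  define K where "K = four_block_mat (s \<cdot>\<^sub>m A + (\<i> * s) \<cdot>\<^sub>m mat_adjoint X) (s \<cdot>\<^sub>m X + (\<i> * s) \<cdot>\<^sub>m B)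
      ((\<i> * s) \<cdot>\<^sub>m A + s \<cdot>\<^sub>m mat_adjoint X) ((\<i> * s) \<cdot>\<^sub>m X + s \<cdot>\<^sub>m B)"
  have JM: "J * four_block_mat A X (mat_adjoint X) B = K"
    unfolding J_def K_def using c cX' c_scalar
    by (subst square_block_mult[where n = n]) (simp_all add: scalar)
  define R S where "R = (- \<i> * s) \<cdot>\<^sub>m (s \<cdot>\<^sub>m A + (\<i> * s) \<cdot>\<^sub>m mat_adjoint X) + s \<cdot>\<^sub>m (s \<cdot>\<^sub>m X + (\<i> * s) \<cdot>\<^sub>m B)"
    and "S = s \<cdot>\<^sub>m ((\<i> * s) \<cdot>\<^sub>m A + s \<cdot>\<^sub>m mat_adjoint X) + (- \<i> * s) \<cdot>\<^sub>m ((\<i> * s) \<cdot>\<^sub>m X + s \<cdot>\<^sub>m B)"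
  have RS: "R \<in> carrier_mat n n" "S \<in> carrier_mat n n" using c cX' by (auto simp: R_def S_def)
  have cK: "s \<cdot>\<^sub>m A + (\<i> * s) \<cdot>\<^sub>m mat_adjoint X \<in> carrier_mat n n" "s \<cdot>\<^sub>m X + (\<i> * s) \<cdot>\<^sub>m B \<in> carrier_mat n n"
    "(\<i> * s) \<cdot>\<^sub>m A + s \<cdot>\<^sub>m mat_adjoint X \<in> carrier_mat n n" "(\<i> * s) \<cdot>\<^sub>m X + s \<cdot>\<^sub>m B \<in> carrier_mat n n"
    using c cX' by auto
  have s2: "s * (s * z) = z / 2" for z using ss by (simp add: mult.assoc[symmetric])
  have ac: "s * (\<i> * (s * z)) = \<i> * (s * (s * z))" for z by (simp add: mult_ac)
  have TL: "s \<cdot>\<^sub>m (s \<cdot>\<^sub>m A + (\<i> * s) \<cdot>\<^sub>m mat_adjoint X) + (- \<i> * s) \<cdot>\<^sub>m (s \<cdot>\<^sub>m X + (\<i> * s) \<cdot>\<^sub>m B)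
      = (1/2) \<cdot>\<^sub>m (A + B) + (- \<i> / 2) \<cdot>\<^sub>m Y"
    unfolding Y_def using c by (intro eq_matI) (auto simp: distrib_left right_diff_distrib mult.assoc ac s2 field_simps)
  have BR: "(- \<i> * s) \<cdot>\<^sub>m ((\<i> * s) \<cdot>\<^sub>m A + s \<cdot>\<^sub>m mat_adjoint X) + s \<cdot>\<^sub>m ((\<i> * s) \<cdot>\<^sub>m X + s \<cdot>\<^sub>m B)
      = (1/2) \<cdot>\<^sub>m (A + B) + (\<i> / 2) \<cdot>\<^sub>m Y"
    unfolding Y_def using c by (intro eq_matI) (auto simp: distrib_left right_diff_distrib mult.assoc ac s2 field_simps)
  have "J * four_block_mat A X (mat_adjoint X) B * mat_adjoint J
      = four_block_mat ((1/2) \<cdot>\<^sub>m (A + B) + (- \<i> / 2) \<cdot>\<^sub>m Y) R S ((1/2) \<cdot>\<^sub>m (A + B) + (\<i> / 2) \<cdot>\<^sub>m Y)"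
    unfolding JM aJ unfolding K_def R_def S_def TL[symmetric] BR[symmetric]
    by (subst square_block_mult[where n = n], (rule cK c_scalar)+, unfold scalar[OF cK(1)] scalar[OF cK(2)]
        scalar[OF cK(3)] scalar[OF cK(4)], rule refl)
  with J RS show ?thesis using that by blast
qed

text \<open>The constant of the final estimate: a factor \<open>2\<close> for the two diagonal blocks, one quasi-triangle constant for the block
  estimate, one for the sum of \<open>A + B\<close> and \<open>\<bar>X - X\<^sup>*\<bar>\<close>, and \<open>2 powr (- p)\<close> for halving that sum.\<close>

lemma quasi_const_square:
  assumes "p > 0"
  shows "2 * (quasi_const p * (2 powr (- p) * quasi_const p)) = 2 powr \<bar>p - 1\<bar>"
proof (cases "p \<ge> 1")
  case True
  have "(1::real) \<le> 2 powr (p - 1)" using True by (simp add: ge_one_powr_ge_zero)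
  then have "quasi_const p = 2 powr (p - 1)" by (simp add: quasi_const_def)
  moreover have "2 powr 1 * (2 powr (p - 1) * (2 powr (- p) * 2 powr (p - 1))) = (2::real) powr (p - 1)"
    by (simp only: powr_add[symmetric]) (simp add: algebra_simps)
  ultimately show ?thesis using True by simp
next
  case False
  have "(2::real) powr (p - 1) \<le> 2 powr 0" using False by (intro powr_mono) auto
  then have "quasi_const p = 1" by (simp add: quasi_const_def)
  moreover have "2 powr 1 * 2 powr (- p) = (2::real) powr (1 - p)"
    by (simp only: powr_add[symmetric]) simp
  ultimately show ?thesis using False by simp
qed

text \<open>The matrix \<open>X - X\<^sup>*\<close> is \<open>2 i\<close> times a Hermitian matrix \<open>K\<close>, so its absolute value is \<open>2 \<bar>K\<bar>\<close> and is diagonal in the same basis as \<open>K\<close>.\<close>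

lemma mat_abs_skew:
  assumes X: "X \<in> carrier_mat n n"
  defines "Y \<equiv> X - mat_adjoint X"
  obtains W k where "W \<in> unitary_mats n" "mat_abs Y = diag_conj W (\<lambda>i. 2 * \<bar>k i\<bar>)"
    "(- \<i> / 2) \<cdot>\<^sub>m Y = diag_conj W k" "(\<i> / 2) \<cdot>\<^sub>m Y = diag_conj W (\<lambda>i. - k i)"
proof -
  have Y: "Y \<in> carrier_mat n n" using X by (auto simp: Y_def)
  define K where "K = (- \<i> / 2) \<cdot>\<^sub>m Y"
  have K: "K \<in> carrier_mat n n" using Y by (simp add: K_def)
  have hK: "mat_adjoint K = K"
    using X by (intro eq_matI) (auto simp: K_def Y_def algebra_simps)
  obtain es where "char_poly K = (\<Prod>e\<leftarrow>es. [:- e, 1:])"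
    using char_poly_factorized[OF K] by blast
  then obtain W k where W: "W \<in> unitary_mats n" "K = diag_conj W k"
    using spectral_theorem_list[OF K hK] by blast
  note cW = unitary_carrier[OF W(1)]
  have YK: "Y = (2 * \<i>) \<cdot>\<^sub>m K" "mat_adjoint Y = (- 2 * \<i>) \<cdot>\<^sub>m K"
  proof -
    show "Y = (2 * \<i>) \<cdot>\<^sub>m K" using Y by (intro eq_matI) (auto simp: K_def)
    have "mat_adjoint Y = mat_adjoint ((2 * \<i>) \<cdot>\<^sub>m K)" using \<open>Y = (2 * \<i>) \<cdot>\<^sub>m K\<close> by simp
    also have "\<dots> = (- 2 * \<i>) \<cdot>\<^sub>m mat_adjoint K" using K by (intro eq_matI) auto
    finally show "mat_adjoint Y = (- 2 * \<i>) \<cdot>\<^sub>m K" by (simp only: hK)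
  qed
  have "mat_adjoint Y * Y = complex_of_real 4 \<cdot>\<^sub>m (K * K)"
    unfolding YK(2) unfolding YK(1) using K
    by (intro eq_matI) (auto simp: mult_smult_distrib[of _ n n _ n] mult_smult_assoc_mat[of _ n n _ n])
  also have "\<dots> = diag_conj W (\<lambda>i. 4 * (k i * k i))"
    by (simp only: W(2) diag_conj_mult[OF W(1)] diag_conj_smult[OF cW])
  finally have "mat_abs Y = diag_conj W (\<lambda>i. (4 * (k i * k i)) powr (1/2))"
    by (simp add: mat_abs_def psd_power_diag_conj[OF W(1)])
  also have "\<dots> = diag_conj W (\<lambda>i. 2 * \<bar>k i\<bar>)"
  proof (rule diag_conj_cong[OF cW])
    fix i
    have "4 * (k i * k i) = (2 * \<bar>k i\<bar>)\<^sup>2" by (simp add: power2_eq_square)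
    then show "(4 * (k i * k i)) powr (1/2) = 2 * \<bar>k i\<bar>" by (simp only: powr_half_sqrt zero_le_power2 real_sqrt_abs)
  qed
  finally have abs: "mat_abs Y = diag_conj W (\<lambda>i. 2 * \<bar>k i\<bar>)" .
  have "(\<i> / 2) \<cdot>\<^sub>m Y = complex_of_real (- 1) \<cdot>\<^sub>m K"
    using Y by (intro eq_matI) (auto simp: K_def)
  also have "\<dots> = diag_conj W (\<lambda>i. - k i)"
    unfolding W(2) diag_conj_smult[OF cW] by simp
  finally show ?thesis using that[OF W(1) abs _ ] W(2) by (simp add: K_def)
qed

theorem corollary2p4:
  fixes n :: nat and A B X :: "complex mat" and N :: "complex mat \<Rightarrow> real" and p :: real
  assumes "n \<ge> 1"
    and "A \<in> carrier_mat n n" and "B \<in> carrier_mat n n" and "X \<in> carrier_mat n n"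
    and "four_block_mat A X (mat_adjoint X) B \<in> psd_mats (2 * n)"
    and "symmetric_norm (2 * n) N"
    and "p > 0"
  shows "N (psd_power (four_block_mat A X (mat_adjoint X) B) p)
    \<le> 2 powr \<bar>p - 1\<bar> * (induced_norm n N (psd_power (A + B) p)
        + induced_norm n N (psd_power (mat_abs (X - mat_adjoint X)) p))"
proof -
  note c = assms(2-4) and p = \<open>p > 0\<close>
  have cX': "mat_adjoint X \<in> carrier_mat n n" using c by simp
  let ?M = "four_block_mat A X (mat_adjoint X) B"
  have M: "?M \<in> psd_mats (n + n)" and N: "symmetric_norm (n + n) N"
    using assms(5,6) by (simp_all add: mult_2)
  let ?\<nu> = "induced_norm n N"
  note \<nu> = symmetric_norm_induced[OF N]
  define Y where "Y = X - mat_adjoint X"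
  define H where "H = mat_abs Y"
  obtain W k where W: "W \<in> unitary_mats n" and H_eq: "H = diag_conj W (\<lambda>i. 2 * \<bar>k i\<bar>)"
    and K: "(- \<i> / 2) \<cdot>\<^sub>m Y = diag_conj W k" "(\<i> / 2) \<cdot>\<^sub>m Y = diag_conj W (\<lambda>i. - k i)"
    using mat_abs_skew[OF c(3)] unfolding H_def Y_def by blast
  note cW = unitary_carrier[OF W]
  have H: "H \<in> psd_mats n" unfolding H_eq by (rule diag_conj_psd[OF cW]) simp
  have AB: "A + B \<in> psd_mats n"
    using psd_diagonal_block[OF M c(1) c(3) cX' c(2)] by (intro psd_add)
  obtain J R S where J: "J \<in> unitary_mats (n + n)" "R \<in> carrier_mat n n" "S \<in> carrier_mat n n"
    and JMJ: "J * ?M * mat_adjoint J = four_block_mat ((1/2) \<cdot>\<^sub>m (A + B) + diag_conj W k) R S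
      ((1/2) \<cdot>\<^sub>m (A + B) + diag_conj W (\<lambda>i. - k i))"
    using block_rotation[OF c] unfolding Y_def[symmetric] K by blast
  define P where "P = (\<lambda>k. (1/2) \<cdot>\<^sub>m (A + B) + diag_conj W k)"
  have cP: "P k \<in> carrier_mat n n" for k using psd_carrier[OF AB] cW by (simp add: P_def)
  have "mat_adjoint (mat_adjoint J) * ?M * mat_adjoint J \<in> psd_mats (n + n)"
    using unitary_carrier[OF J(1)] by (intro psd_congruence[OF M]) auto
  then have M': "four_block_mat (P k) R S (P (\<lambda>i. - k i)) \<in> psd_mats (n + n)"
    by (simp add: JMJ P_def)
  \<comment> \<open>Used for \<open>l = k\<close> and \<open>l = - k\<close>, that is, for the two diagonal blocks.\<close>
  have bound: "?\<nu> (psd_power (P l) p) \<le> 2 powr (- p) * quasi_const p * (?\<nu> (psd_power (A + B) p) + ?\<nu> (psd_power H p))"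
    if Pl: "P l \<in> psd_mats n" and l: "\<And>i. \<bar>l i\<bar> = \<bar>k i\<bar>" for l
  proof -
    note ABH = psd_add[OF AB H]
    let ?Q = "complex_of_real (1/2) \<cdot>\<^sub>m (A + B + H)"
    have Q: "?Q \<in> psd_mats n" using ABH by (rule psd_smult) simp
    have "?\<nu> (psd_power (P l) p) \<le> ?\<nu> (psd_power ?Q p)"
    proof (rule norm_power_mono[OF \<nu> p Pl Q])
      fix v :: "complex vec" assume v: "v \<in> carrier_vec n"
      have "quad_form (diag_conj W l) v \<le> 1/2 * quad_form H v"
        unfolding H_eq quad_form_diag_conj[OF cW v] sum_distrib_left
      proof (rule sum_mono)
        fix i
        have "l i \<le> \<bar>k i\<bar>" using l[of i] by simp
        then show "l i * (cmod ((mat_adjoint W *\<^sub>v v) $ i))\<^sup>2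
            \<le> 1/2 * (2 * \<bar>k i\<bar> * (cmod ((mat_adjoint W *\<^sub>v v) $ i))\<^sup>2)"
          by (simp add: mult_right_mono)
      qed
      moreover have "quad_form (P l) v = 1/2 * quad_form (A + B) v + quad_form (diag_conj W l) v"
        using quad_form_add[of "(1/2) \<cdot>\<^sub>m (A + B)" n "diag_conj W l" v]
          quad_form_smult[OF psd_carrier[OF AB] v, of "1/2"] psd_carrier[OF AB] cW v by (simp add: P_def)
      moreover have "quad_form ?Q v = 1/2 * (quad_form (A + B) v + quad_form H v)"
        by (simp only: quad_form_smult[OF psd_carrier[OF ABH] v]
          quad_form_add[OF psd_carrier[OF AB] psd_carrier[OF H] v])
      ultimately show "quad_form (P l) v \<le> quad_form ?Q v" by simp
    qed
    also have "\<dots> = (1/2) powr p * ?\<nu> (psd_power (A + B + H) p)"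
      using psd_power_smult[OF ABH, of "1/2" p] norm_smult[OF \<nu> psd_power_carrier[OF ABH], of "(1/2) powr p"] by simp
    also have "(1/2::real) powr p = 2 powr (- p)" by (simp add: powr_minus powr_divide inverse_eq_divide)
    also have "2 powr (- p) * ?\<nu> (psd_power (A + B + H) p)
        \<le> 2 powr (- p) * (quasi_const p * (?\<nu> (psd_power (A + B) p) + ?\<nu> (psd_power H p)))"
      by (intro mult_left_mono induced_norm_power_add[OF N p AB H]) simp
    finally show ?thesis by (simp only: mult.assoc)
  qed
  have Ppsd: "P k \<in> psd_mats n" "P (\<lambda>i. - k i) \<in> psd_mats n"
    using psd_diagonal_block[OF M' cP J(2,3) cP] by auto
  let ?b = "?\<nu> (psd_power (A + B) p) + ?\<nu> (psd_power H p)"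
  have "N (psd_power ?M p) = N (psd_power (J * ?M * mat_adjoint J) p)"
    unfolding psd_power_unitary_conj[OF M J(1)]
    by (rule norm_conj[OF N psd_power_carrier[OF M] J(1), symmetric])
  also have "\<dots> \<le> quasi_const p * (?\<nu> (psd_power (P k) p) + ?\<nu> (psd_power (P (\<lambda>i. - k i)) p))"
    using norm_power_block_le[OF N p M' cP J(2,3) cP] by (simp add: JMJ P_def)
  also have "\<dots> \<le> quasi_const p * (2 powr (- p) * quasi_const p * ?b + 2 powr (- p) * quasi_const p * ?b)"
    using quasi_const_pos[of p] by (intro mult_left_mono add_mono bound Ppsd) auto
  also have "\<dots> = 2 * (quasi_const p * (2 powr (- p) * quasi_const p)) * ?b"
    by (simp add: algebra_simps)
  also have "\<dots> = 2 powr \<bar>p - 1\<bar> * ?b"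
    by (simp only: quasi_const_square[OF p])
  finally show ?thesis by (simp only: H_def Y_def)
qed

end
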